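(* Let $P_\ell$ denote the path with $\ell$ edges, and let $k^*(P_\ell,2)$ be the smallest integer $k$ for which Builder has a winning strategy in the deterministic $P_\ell$-avoidance game with $2$ colors and tree size restriction $k$. Then, as $\ell\to\infty$, \[ (8/15+o(1))\cdot \ell^2 \;\leq\; k^*(P_\ell,2)\;\leq\; O\big(\ell^{2\log_2(1+\sqrt{3})}\big). \]
   Context: Deterministic $F$-avoidance game with $r$ colors and tree size restriction $k$: two players Builder and Painter play on a board with $a$ vertices, initially without edges. In each step Builder presents a new edge, which Painter must immediately color with one of $r$ colors; Painter loses as soon as a monochromatic copy of $F$ is created. Builder must never create a cycle on the board nor a component (tree) with more than $k$ edges. Builder has a winning strategy if for some large enough $a$ he can force Painter to create a monochromatic copy of $F$ on a board with $a$ vertices. Note $2\log_2(1+\sqrt3)=2.899\ldots$. *)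

theory Defs
  imports "HOL-Library.Landau_Symbols"
begin

text \<open>Finite simple undirected graphs as pairs of a vertex set and a set of two-element vertex sets.\<close>

type_synonym 'v sgraph = "'v set \<times> 'v set set"

definition path_graph :: "nat \<Rightarrow> nat sgraph" where
  "path_graph l = ({0..l}, {{i, Suc i} | i. i < l})"

definition is_cycle :: "'v set set \<Rightarrow> 'v list \<Rightarrow> bool" where
  "is_cycle E vs \<longleftrightarrow> 3 \<le> length vs \<and> distinct vs \<and>
     (\<forall>i<length vs. {vs ! i, vs ! (Suc i mod length vs)} \<in> E)"

definition is_forest :: "'v set set \<Rightarrow> bool" where
  "is_forest E \<longleftrightarrow> (\<nexists>vs. is_cycle E vs)"

definition component_edges :: "'v set set \<Rightarrow> 'v \<Rightarrow> 'v set set" where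
  "component_edges E v = {e \<in> E. \<exists>u\<in>e. (v, u) \<in> {(x, y). {x, y} \<in> E}\<^sup>*}"

text \<open>
  A position on the board with vertex set \<open>{..<a}\<close> is the partial map sending each edge presented
  so far to its color; the colors are the numbers below \<open>r\<close>.
\<close>

type_synonym position = "nat set \<rightharpoonup> nat"

definition legal_move :: "nat \<Rightarrow> nat \<Rightarrow> position \<Rightarrow> nat set \<Rightarrow> bool" where
  "legal_move a k s e \<longleftrightarrow>
     e \<subseteq> {..<a} \<and> card e = 2 \<and> e \<notin> dom s \<and>
     is_forest (insert e (dom s)) \<and>
     (\<forall>v<a. card (component_edges (insert e (dom s)) v) \<le> k)"

definition has_mono_copy :: "'v sgraph \<Rightarrow> nat \<Rightarrow> nat \<Rightarrow> position \<Rightarrow> bool" where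
  "has_mono_copy F r a s \<longleftrightarrow>
     (\<exists>c<r. \<exists>f. inj_on f (fst F) \<and> f ` fst F \<subseteq> {..<a} \<and> (\<forall>e\<in>snd F. s (f ` e) = Some c))"

text \<open>
  The positions from which Builder can force a monochromatic copy of \<open>F\<close>. Being a least fixed
  point, the predicate requires the copy to appear after finitely many steps; if Builder has no
  legal move left before that, he has not won.
\<close>

inductive builder_forces :: "'v sgraph \<Rightarrow> nat \<Rightarrow> nat \<Rightarrow> nat \<Rightarrow> position \<Rightarrow> bool"
  for F :: "'v sgraph" and r a k :: nat where
  copy: "has_mono_copy F r a s \<Longrightarrow> builder_forces F r a k s"
| move: "legal_move a k s e \<Longrightarrow> (\<And>c. c < r \<Longrightarrow> builder_forces F r a k (s(e \<mapsto> c)))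
          \<Longrightarrow> builder_forces F r a k s"

definition builder_wins :: "'v sgraph \<Rightarrow> nat \<Rightarrow> nat \<Rightarrow> bool" where
  "builder_wins F r k \<longleftrightarrow> (\<exists>a. builder_forces F r a k Map.empty)"

text \<open>Only meaningful if Builder wins for some \<open>k\<close>; otherwise the value is unspecified.\<close>

definition kstar :: "'v sgraph \<Rightarrow> nat \<Rightarrow> nat" where
  "kstar F r = (LEAST k. builder_wins F r k)"

end

theory Submission
  imports Defs
begin

text \<open>
  Lower bound: Painter colors an edge red unless this creates a red path with two edges, then blue
  unless this creates a blue path with four edges, then red unless this creates a red \<open>P\<^sub>l\<close>, then blue.
  On a red path, of any two consecutive edges one has, at the moment it is presented, blue paths of
  total length at least three at its ends, and every blue edge has an earlier red neighbour. The cheapest way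
  to achieve this costs five further edges for every three vertices, so a red path of length \<open>x\<close>
  needs about \<open>8x / 3\<close> edges. Of any four consecutive edges of the final blue \<open>P\<^sub>l\<close> one has red paths of
  total length \<open>l - 1\<close> at its ends, so every five vertices account for about \<open>8l / 3\<close> edges.

  Upper bound: let \<open>K(p, q)\<close> edges suffice to force a red path of length \<open>2\<^sup>p - 1\<close> or a blue path of length
  \<open>2\<^sup>q - 1\<close>. Playing for \<open>(p, q)\<close>, and then for \<open>(p + 1, q)\<close> or \<open>(p, q + 1)\<close>, Builder gets a path of
  each color, and an edge between their ends makes one vertex the end of both. Joining two such
  vertices doubles the path in the color Painter chooses, so
  \<open>K(p + 1, q + 1) \<le> 2 max (K(p + 1, q)) (K(p, q + 1)) + 2 K(p, q) + 3\<close>, and \<open>1 + sqrt 3\<close> is the root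
  of \<open>x\<^sup>2 = 2 x + 2\<close>.
\<close>

section \<open>Paths in forests\<close>

definition conn :: "'v set set \<Rightarrow> ('v \<times> 'v) set" where
  "conn E = {(x, y). {x, y} \<in> E}\<^sup>*"

definition is_path :: "'v set set \<Rightarrow> (nat \<Rightarrow> 'v) \<Rightarrow> nat \<Rightarrow> bool" where
  "is_path E p n \<longleftrightarrow> inj_on p {..n} \<and> (\<forall>i<n. {p i, p (Suc i)} \<in> E)"

definition path_from :: "'v set set \<Rightarrow> 'v \<Rightarrow> nat \<Rightarrow> bool" where
  "path_from E v n \<longleftrightarrow> (\<exists>p. is_path E p n \<and> p 0 = v)"

definition path_edges :: "(nat \<Rightarrow> 'v) \<Rightarrow> nat \<Rightarrow> 'v set set" where
  "path_edges p n = (\<lambda>i. {p i, p (Suc i)}) ` {..<n}"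

text \<open>The length \<open>L\<close> counts \<open>e\<close> itself. The two paths need not be
  required to be disjoint: when \<open>e\<close> is a new edge and \<open>E\<close> with
  \<open>e\<close> is a forest, its ends lie in different components of \<open>E\<close>. So the
  formula says that adding \<open>e\<close> creates a path with \<open>L\<close> edges through
  \<open>e\<close>.\<close>

definition closes :: "'v set set \<Rightarrow> 'v set \<Rightarrow> nat \<Rightarrow> bool" where
  "closes E e L \<longleftrightarrow> (\<exists>u v m n. e = {u, v} \<and> path_from E u m \<and> path_from E v n \<and> Suc (m + n) = L)"

lemma component_edges_conn: "component_edges E v = {e \<in> E. \<exists>u\<in>e. (v, u) \<in> conn E}"
  by (simp add: component_edges_def conn_def)

lemma conn_refl [simp]: "(x, x) \<in> conn E"
  by (simp add: conn_def)

lemma conn_trans: "(x, y) \<in> conn E \<Longrightarrow> (y, z) \<in> conn E \<Longrightarrow> (x, z) \<in> conn E"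
  by (simp add: conn_def)

lemma conn_edge: "{x, y} \<in> E \<Longrightarrow> (x, y) \<in> conn E"
  by (auto simp: conn_def)

lemma conn_sym: "(x, y) \<in> conn E \<Longrightarrow> (y, x) \<in> conn E"
proof -
  have "sym {(x, y). {x, y} \<in> E}"
    by (auto simp: sym_def insert_commute)
  then show "(x, y) \<in> conn E \<Longrightarrow> (y, x) \<in> conn E"
    unfolding conn_def by (meson sym_rtrancl symE)
qed

lemma conn_mono: "(x, y) \<in> conn E \<Longrightarrow> E \<subseteq> E' \<Longrightarrow> (x, y) \<in> conn E'"
  unfolding conn_def by (rule subsetD[OF rtrancl_mono]) auto

lemma conn_induct [consumes 1, case_names base step]:
  assumes "(x, y) \<in> conn E" "P x" "\<And>y z. (x, y) \<in> conn E \<Longrightarrow> {y, z} \<in> E \<Longrightarrow> P y \<Longrightarrow> P z"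
  shows "P y"
  using assms(1) unfolding conn_def
  by (induction rule: rtrancl_induct) (use assms(2,3) in \<open>auto simp: conn_def\<close>)

lemma is_path_mono: "is_path E p n \<Longrightarrow> E \<subseteq> E' \<Longrightarrow> is_path E' p n"
  by (auto simp: is_path_def)

lemma is_path_eq_iff:
  "is_path E p n \<Longrightarrow> i \<le> n \<Longrightarrow> j \<le> n \<Longrightarrow> p i = p j \<longleftrightarrow> i = j"
  by (auto simp: is_path_def inj_on_def)

lemma is_path_shift:
  assumes "is_path E p n" "k + m \<le> n"
  shows "is_path E (\<lambda>i. p (k + i)) m"
proof -
  have "inj_on (\<lambda>i. p (k + i)) {..m}"
    using is_path_eq_iff[OF assms(1)] assms(2) by (intro inj_onI) auto
  then show ?thesis using assms by (simp add: is_path_def)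
qed

lemma is_path_rev:
  assumes "is_path E p n" "k \<le> n" "m \<le> k"
  shows "is_path E (\<lambda>i. p (k - i)) m"
proof -
  have "{p (k - i), p (k - Suc i)} \<in> E" if "i < m" for i
  proof -
    have "k - i = Suc (k - Suc i)" using that assms by simp
    then show ?thesis using assms that by (auto simp: is_path_def insert_commute)
  qed
  moreover have "inj_on (\<lambda>i. p (k - i)) {..m}"
  proof (rule inj_onI)
    fix i j assume *: "i \<in> {..m}" "j \<in> {..m}" "p (k - i) = p (k - j)"
    then have "k - i = k - j"
      using assms by (intro inj_onD[of p "{..n}"]) (auto simp: is_path_def)
    then show "i = j" using * assms by auto
  qed
  ultimately show ?thesis by (simp add: is_path_def)
qed

lemma is_path_conn:
  assumes "is_path E p n" "i \<le> n" "j \<le> n"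
  shows "(p i, p j) \<in> conn E"
proof -
  have "(p 0, p i) \<in> conn E" if "i \<le> n" for i
    using that
  proof (induction i)
    case (Suc i)
    then show ?case
      using assms(1) by (meson Suc_le_lessD conn_edge conn_trans is_path_def less_imp_le)
  qed simp
  then show ?thesis using assms by (meson conn_sym conn_trans)
qed

lemma path_from_le: "path_from E v n \<Longrightarrow> m \<le> n \<Longrightarrow> path_from E v m"
  unfolding path_from_def by (metis add_0 is_path_shift)

lemma path_from_mono: "path_from E v n \<Longrightarrow> E \<subseteq> E' \<Longrightarrow> path_from E' v n"
  unfolding path_from_def by (metis is_path_mono)

lemma path_from_0 [simp]: "path_from E v 0"
  unfolding path_from_def is_path_def by auto

lemma path_edges_subset: "is_path E p n \<Longrightarrow> path_edges p n \<subseteq> E"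
  by (auto simp: is_path_def path_edges_def)

lemma path_edge_inj:
  assumes "inj_on p {..n}" "i < n" "j < n" "{p i, p (Suc i)} = {p j, p (Suc j)}"
  shows "i = j"
proof -
  have *: "p x = p y \<longleftrightarrow> x = y" if "x \<le> n" "y \<le> n" for x y
    using that assms(1) by (auto simp: inj_on_def)
  show ?thesis
    using assms(2-4) *[of i j] *[of i "Suc j"] *[of "Suc i" j] *[of "Suc i" "Suc j"]
    by (auto simp: doubleton_eq_iff)
qed

lemma card_path_edges:
  assumes "is_path E p n"
  shows "card (path_edges p n) = n"
  unfolding path_edges_def
proof (subst card_image)
  show "inj_on (\<lambda>i. {p i, p (Suc i)}) {..<n}"
    using assms by (intro inj_onI) (auto intro: path_edge_inj simp: is_path_def)
qed simp

lemma closes_le: "closes E e L \<Longrightarrow> 1 \<le> L' \<Longrightarrow> L' \<le> L \<Longrightarrow> closes E e L'"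
proof -
  assume "closes E e L" and L: "1 \<le> L'" "L' \<le> L"
  then obtain u v m n where *: "e = {u, v}" "path_from E u m" "path_from E v n" "Suc (m + n) = L"
    by (auto simp: closes_def)
  have "path_from E u (min m (L' - 1))" "path_from E v (L' - 1 - min m (L' - 1))"
    using * L by (auto intro: path_from_le)
  moreover have "Suc (min m (L' - 1) + (L' - 1 - min m (L' - 1))) = L'"
    using L by auto
  ultimately show ?thesis using *(1) unfolding closes_def by blast
qed

lemma conn_imp_path:
  assumes "(x, y) \<in> conn E"
  shows "\<exists>p n. is_path E p n \<and> p 0 = x \<and> p n = y"
  using assms
proof (induction rule: conn_induct)
  case base
  have "is_path E (\<lambda>_. x) 0" by (simp add: is_path_def)
  then show ?case by blast
next
  case (step y z)
  then obtain p n where p: "is_path E p n" "p 0 = x" "p n = y" by blast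
  show ?case
  proof (cases "\<exists>i\<le>n. p i = z")
    case True
    then obtain i where "i \<le> n" "p i = z" by blast
    moreover have "is_path E p i"
      using is_path_shift[OF p(1), of 0 i] \<open>i \<le> n\<close> by simp
    ultimately show ?thesis using p by blast
  next
    case False
    let ?p = "p(Suc n := z)"
    have "inj_on ?p {..Suc n}"
      using p(1) False by (auto simp: inj_on_def is_path_def le_Suc_eq)
    moreover have "{?p i, ?p (Suc i)} \<in> E" if "i < Suc n" for i
      using that p step.hyps(2) by (cases "i = n") (auto simp: is_path_def)
    ultimately have "is_path E ?p (Suc n)" by (simp add: is_path_def)
    moreover have "?p 0 = x" "?p (Suc n) = z" using p by auto
    ultimately show ?thesis by blast
  qed
qed

section \<open>Deleting edges of a forest separates vertices\<close>

lemma forest_bridge: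
  assumes "is_forest E" "{u, v} \<in> E" "u \<noteq> v"
  shows "(u, v) \<notin> conn (E - {{u, v}})"
proof
  assume "(u, v) \<in> conn (E - {{u, v}})"
  then obtain p n where p: "is_path (E - {{u, v}}) p n" "p 0 = u" "p n = v"
    using conn_imp_path by metis
  \<comment> \<open>A path with one edge would be the deleted edge itself. Hence the path has at
    least three vertices, and the deleted edge closes it to a cycle.\<close>
  have "n \<noteq> 0" "n \<noteq> 1" using p assms(3) by (auto simp: is_path_def)
  let ?vs = "map p [0..<Suc n]"
  have "{?vs ! i, ?vs ! (Suc i mod length ?vs)} \<in> E" if "i < length ?vs" for i
  proof (cases "i = n")
    case True
    then have "?vs ! i = v" "?vs ! (Suc i mod length ?vs) = u"
      using p by (simp_all add: nth_append del: upt_Suc)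
    then show ?thesis using assms(2) by (simp add: insert_commute)
  next
    case False
    then have "i < n" using that by simp
    then have "?vs ! i = p i" "?vs ! (Suc i mod length ?vs) = p (Suc i)"
      by (simp_all del: upt_Suc)
    then show ?thesis using p(1) \<open>i < n\<close> by (auto simp: is_path_def)
  qed
  moreover have "distinct ?vs"
    using p(1) by (auto simp: distinct_map is_path_def atLeast0_lessThan_Suc lessThan_Suc_atMost
        atLeast0LessThan simp del: upt_Suc)
  ultimately have "is_cycle E ?vs"
    using \<open>n \<noteq> 0\<close> \<open>n \<noteq> 1\<close> unfolding is_cycle_def by (simp del: upt_Suc)
  then show False using assms(1) by (auto simp: is_forest_def)
qed

text \<open>A connection between \<open>p i\<close> and \<open>p j\<close> off the path, followed by
  the part of the path from \<open>p j\<close> back to \<open>p (Suc i)\<close>, would bypass the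
  edge after \<open>p i\<close>, which is a bridge.\<close>

lemma forest_path_separated:
  assumes "is_forest E" "is_path E p n" "i \<le> n" "j \<le> n" "i \<noteq> j"
  shows "(p i, p j) \<notin> conn (E - path_edges p n)"
proof -
  have *: "(p i, p j) \<notin> conn (E - path_edges p n)" if "i < j" "j \<le> n" for i j
  proof
    assume c: "(p i, p j) \<in> conn (E - path_edges p n)"
    let ?e = "{p i, p (Suc i)}"
    have inj: "inj_on p {..n}" using assms(2) by (simp add: is_path_def)
    have e: "?e \<in> E" "p i \<noteq> p (Suc i)"
      using assms(2) that is_path_eq_iff[OF assms(2), of i "Suc i"] by (auto simp: is_path_def)
    have "(p i, p j) \<in> conn (E - {?e})"
      using c by (rule conn_mono) (use that in \<open>auto simp: path_edges_def\<close>)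
    moreover have "is_path (E - {?e}) (\<lambda>k. p (Suc i + k)) (j - Suc i)"
    proof -
      have "{p (Suc i + k), p (Suc (Suc i + k))} \<noteq> ?e" if "k < j - Suc i" for k
      proof -
        have "Suc i + k < n" using that \<open>j \<le> n\<close> by linarith
        then show ?thesis using path_edge_inj[OF inj, of "Suc i + k" i] by auto
      qed
      then show ?thesis
        using is_path_shift[OF assms(2), of "Suc i" "j - Suc i"] that by (auto simp: is_path_def)
    qed
    from is_path_conn[OF this, of 0 "j - Suc i"] have "(p (Suc i), p j) \<in> conn (E - {?e})"
      using that by simp
    ultimately have "(p i, p (Suc i)) \<in> conn (E - {?e})"
      using conn_trans conn_sym by meson
    then show False using forest_bridge[OF assms(1) e] by simp
  qed
  show ?thesis
    using *[of i j] *[of j i] assms by (metis conn_sym nat_neq_iff)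
qed

lemma component_edges_disjoint:
  assumes "\<And>e. e \<in> E \<Longrightarrow> card e = 2" "(x, y) \<notin> conn E"
  shows "component_edges E x \<inter> component_edges E y = {}"
proof (rule ccontr)
  assume "\<not> ?thesis"
  then obtain e u v where e: "e \<in> E" "u \<in> e" "v \<in> e" "(x, u) \<in> conn E" "(y, v) \<in> conn E"
    by (auto simp: component_edges_conn)
  have "(u, v) \<in> conn E"
  proof (cases "u = v")
    case False
    then have "e = {u, v}" using assms(1)[OF e(1)] e(2,3) by (auto simp: card_2_iff)
    then show ?thesis using e(1) conn_edge by metis
  qed simp
  then show False using assms(2) e by (meson conn_trans conn_sym)
qed

text \<open>Every edge of a walk from \<open>x\<close> belongs to the component of \<open>x\<close>,
  so none of them is lost. This allows the deleted edges to be exchanged when trees hanging at two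
  different paths are compared.\<close>

lemma conn_Diff:
  assumes "(x, y) \<in> conn E" "component_edges E x \<inter> D = {}"
  shows "(x, y) \<in> conn (E - D)"
  using assms(1)
proof (induction rule: conn_induct)
  case (step y z)
  then have "{y, z} \<in> component_edges E x"
    by (auto simp: component_edges_conn)
  then have "{y, z} \<in> E - D" using assms(2) step by blast
  then show ?case using step by (meson conn_trans conn_edge)
qed simp

text \<open>Take the edge of the path that \<open>t\<close> puts last. All others are earlier, and
  they form paths with \<open>i\<close> and \<open>L - Suc i\<close> edges from its two ends. This
  translates a path in the final graph into a situation that Painter faced.\<close>

lemma path_last_edge_closes:
  fixes t :: "'v set \<Rightarrow> nat"
  assumes "is_path C p L" "1 \<le> L" "inj_on t C"
  shows "\<exists>i<L. closes {f \<in> C. t f < t {p i, p (Suc i)}} {p i, p (Suc i)} L"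
proof -
  define e where "e i = {p i, p (Suc i)}" for i
  have "finite (t ` e ` {..<L})" "t ` e ` {..<L} \<noteq> {}"
    using assms(2) by (auto simp: lessThan_empty_iff)
  then obtain i where i: "i < L" "\<forall>j<L. t (e j) \<le> t (e i)"
    using Max_in Max_ge by (smt (verit) imageE imageI lessThan_iff)
  let ?C = "{f \<in> C. t f < t (e i)}"
  have earlier: "e j \<in> ?C" if "j < L" "j \<noteq> i" for j
  proof -
    have inj: "inj_on p {..L}" and C: "e j \<in> C" "e i \<in> C"
      using assms(1) that i by (auto simp: is_path_def e_def)
    have "e j \<noteq> e i" using path_edge_inj[OF inj that(1) i(1)] that by (auto simp: e_def)
    then have "t (e j) \<noteq> t (e i)" using C assms(3) by (meson inj_onD)
    then show ?thesis using i(2) that C by (simp add: le_neq_trans)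
  qed
  have "is_path ?C (\<lambda>k. p (i - k)) i"
  proof -
    have "{p (i - k), p (i - Suc k)} \<in> ?C" if "k < i" for k
      using earlier[of "i - Suc k"] that i(1) by (simp add: e_def insert_commute Suc_diff_Suc)
    then show ?thesis
      using is_path_rev[OF assms(1), of i i] i(1) by (simp add: is_path_def)
  qed
  moreover have "is_path ?C (\<lambda>k. p (Suc i + k)) (L - Suc i)"
  proof -
    have "{p (Suc i + k), p (Suc i + Suc k)} \<in> ?C" if "k < L - Suc i" for k
      using earlier[of "Suc i + k"] that by (simp add: e_def)
    then show ?thesis
      using is_path_shift[OF assms(1), of "Suc i" "L - Suc i"] i(1) by (simp add: is_path_def)
  qed
  ultimately have "path_from ?C (p i) i" "path_from ?C (p (Suc i)) (L - Suc i)"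
    unfolding path_from_def by (metis diff_zero, metis add_0_right)
  moreover have "Suc (i + (L - Suc i)) = L" using i(1) by simp
  ultimately have "closes ?C (e i) L" unfolding closes_def e_def by blast
  then show ?thesis using i(1) unfolding e_def by blast
qed

section \<open>Forests colored by Painter\<close>

text \<open>The path is cut into blocks of two and of three vertices such that the edge following a block
  satisfies \<open>F\<close>.\<close>

lemma block_sum_aux:
  fixes c :: "nat \<Rightarrow> nat"
  assumes "\<And>j. a \<le> j \<Longrightarrow> j + 2 < b \<Longrightarrow> F j \<or> F (j + 1)"
    and "\<And>j. a \<le> j \<Longrightarrow> j + 1 < b \<Longrightarrow> F j \<Longrightarrow> 4 \<le> c j + c (j + 1)"
    and "\<And>j. a \<le> j \<Longrightarrow> j + 2 < b \<Longrightarrow> F j \<Longrightarrow> F (j + 1) \<Longrightarrow> 5 \<le> c j + c (j + 1) + c (j + 2)"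
    and "a + 1 < b \<Longrightarrow> F a"
  shows "5 * (b - a) \<le> 3 * sum c {a..<b} + 10"
  using assms
proof (induction "b - a" arbitrary: a rule: less_induct)
  case less
  note h1 = less.prems(1) and h2 = less.prems(2) and h3 = less.prems(3) and h4 = less.prems(4)
  consider "b \<le> a + 2" | "b = a + 3" | "a + 4 \<le> b" by linarith
  then show ?case
  proof cases
    case 1
    then show ?thesis by simp
  next
    case 2
    then have "{a..<b} = {a, a + 1, a + 2}" by auto
    moreover have "4 \<le> c a + c (a + 1)" using h2[of a] h4 2 by simp
    ultimately show ?thesis using 2 by simp
  next
    case 3
    then have F: "F a" using h4 by simp
    \<comment> \<open>A block of two weighs 4 and a block of three weighs 5, so 5/3 per vertex is
      guaranteed. Two vertices suffice if the next block can start with \<open>F (a + 2)\<close>. If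
      this fails although \<open>F (a + 1)\<close> holds, three are taken, and \<open>h1\<close>
      supplies \<open>F (a + 3)\<close>. The constant 10 pays for a final block of at most two
      vertices.\<close>
    show ?thesis
    proof (cases "F (a + 1) \<and> \<not> F (a + 2)")
      case True
      have "{a..<b} = {a, a + 1, a + 2} \<union> {a + 3..<b}" using 3 by auto
      then have "sum c {a..<b} = c a + c (a + 1) + c (a + 2) + sum c {a + 3..<b}"
        by (simp add: sum.union_disjoint)
      moreover have "5 \<le> c a + c (a + 1) + c (a + 2)" using h3[of a] F True 3 by simp
      moreover have "5 * (b - (a + 3)) \<le> 3 * sum c {a + 3..<b} + 10"
      proof (rule less.hyps)
        show "a + 3 + 1 < b \<Longrightarrow> F (a + 3)" using h1[of "a + 2"] True by (simp add: numeral_3_eq_3)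
      qed (use 3 h1 h2 h3 in auto)
      ultimately show ?thesis using 3 by simp
    next
      case False
      have "{a..<b} = {a, a + 1} \<union> {a + 2..<b}" using 3 by auto
      then have "sum c {a..<b} = c a + c (a + 1) + sum c {a + 2..<b}"
        by (simp add: sum.union_disjoint)
      moreover have "4 \<le> c a + c (a + 1)" using h2[of a] F 3 by simp
      moreover have "5 * (b - (a + 2)) \<le> 3 * sum c {a + 2..<b} + 10"
      proof (rule less.hyps)
        show "a + 2 + 1 < b \<Longrightarrow> F (a + 2)" using h1[of "a + 1"] False by auto
      qed (use 3 h1 h2 h3 in auto)
      ultimately show ?thesis using 3 by simp
    qed
  qed
qed

text \<open>If \<open>F a\<close> fails, the first vertex is given up and \<open>h1\<close> provides
  \<open>F\<close> at the next one. This raises the constant by 5.\<close>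

lemma block_sum:
  fixes c :: "nat \<Rightarrow> nat"
  assumes h1: "\<And>j. a \<le> j \<Longrightarrow> j + 2 < b \<Longrightarrow> F j \<or> F (j + 1)"
    and h2: "\<And>j. a \<le> j \<Longrightarrow> j + 1 < b \<Longrightarrow> F j \<Longrightarrow> 4 \<le> c j + c (j + 1)"
    and h3: "\<And>j. a \<le> j \<Longrightarrow> j + 2 < b \<Longrightarrow> F j \<Longrightarrow> F (j + 1) \<Longrightarrow> 5 \<le> c j + c (j + 1) + c (j + 2)"
  shows "5 * (b - a) \<le> 3 * sum c {a..<b} + 15"
proof (cases "a + 1 < b \<longrightarrow> F a")
  case True
  have "5 * (b - a) \<le> 3 * sum c {a..<b} + 10"
    by (rule block_sum_aux[where F = F]) (use assms True in auto)
  then show ?thesis by simp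
next
  case False
  have "5 * (b - Suc a) \<le> 3 * sum c {Suc a..<b} + 10"
    by (rule block_sum_aux[where F = F]) (use assms False h1[of a] in auto)
  moreover have "sum c {a..<b} = c a + sum c {Suc a..<b}"
    using False by (simp add: sum.atLeast_Suc_lessThan)
  ultimately show ?thesis by simp
qed

lemma closes_2D:
  assumes "closes C e 2"
  shows "\<exists>g\<in>C. g \<inter> e \<noteq> {}"
proof -
  obtain u v m n where uv: "e = {u, v}" "path_from C u m" "path_from C v n" "Suc (m + n) = 2"
    using assms by (auto simp: closes_def)
  have *: "\<exists>g\<in>C. x \<in> g" if "path_from C x 1" for x
    using that by (auto simp: path_from_def is_path_def)
  have "m = 1 \<or> n = 1" using uv(4) by linarith
  then show ?thesis using * uv by fastforce
qed

lemma closes_2I: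
  assumes "is_path E p 2" "{p 1, p 2} \<in> C"
  shows "closes C {p 0, p 1} 2"
proof -
  have "is_path C (\<lambda>i. p (Suc i)) 1"
    using is_path_shift[OF assms(1), of 1 1] assms(2) by (simp add: is_path_def numeral_2_eq_2)
  then have "path_from C (p 1) 1"
    unfolding path_from_def by (intro exI[of _ "\<lambda>i. p (Suc i)"]) simp
  moreover have "Suc (0 + 1) = 2" by simp
  ultimately show ?thesis using path_from_0[of C "p 0"] unfolding closes_def by blast
qed

lemma closesE:
  assumes "closes C {x, y} L"
  obtains m n where "path_from C x m" "path_from C y n" "Suc (m + n) = L"
proof -
  obtain u v m n where uv: "{x, y} = {u, v}" "path_from C u m" "path_from C v n" "Suc (m + n) = L"
    using assms by (auto simp: closes_def)
  then consider "x = u" "y = v" | "x = v" "y = u" by (auto simp: doubleton_eq_iff)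
  then show ?thesis
    by cases (use uv that[of m n] that[of n m] in auto)
qed

text \<open>\<open>R\<close> and \<open>B\<close> are the red and the blue edges, \<open>t\<close> is the order in which they were presented.\<close>

locale painted_forest =
  fixes R B :: "'v set set" and t :: "'v set \<Rightarrow> nat" and l :: nat
  assumes fin: "finite (R \<union> B)" and forest: "is_forest (R \<union> B)"
    and card2: "\<And>e. e \<in> R \<union> B \<Longrightarrow> card e = 2" and disj: "R \<inter> B = {}"
    and inj_t: "inj_on t (R \<union> B)"
    and blueD: "\<And>e. e \<in> B \<Longrightarrow> closes {f \<in> R. t f < t e} e 2"
    and redD: "\<And>e. e \<in> R \<Longrightarrow> closes {f \<in> R. t f < t e} e 2 \<Longrightarrow> closes {f \<in> B. t f < t e} e 4"
    and red_lD: "\<And>e. e \<in> R \<Longrightarrow> \<not> closes {f \<in> R. t f < t e} e l"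
    and blue4D: "\<And>e. e \<in> B \<Longrightarrow> closes {f \<in> B. t f < t e} e 4 \<Longrightarrow> closes {f \<in> R. t f < t e} e l"
begin

section \<open>Trees hanging at the vertices of a red path\<close>

abbreviation hanging :: "(nat \<Rightarrow> 'v) \<Rightarrow> nat \<Rightarrow> nat \<Rightarrow> 'v set set" where
  "hanging p n j \<equiv> component_edges (R \<union> B - path_edges p n) (p j)"

lemma finite_hanging: "finite (hanging p n j)"
  by (rule finite_subset[OF _ fin]) (auto simp: component_edges_def)

text \<open>Because of this the sizes of the trees at different vertices may be added up.\<close>

lemma hanging_disjoint:
  assumes "is_path (R \<union> B) p n" "i \<le> n" "j \<le> n" "i \<noteq> j"
  shows "hanging p n i \<inter> hanging p n j = {}"
  by (rule component_edges_disjoint) (use card2 forest_path_separated[OF forest assms] in auto)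

text \<open>Here \<open>q\<close> is a blue branch leaving the red path at \<open>p j\<close>, all
  of whose edges were presented before the moment \<open>s\<close>. Later \<open>s\<close> is the
  moment at which some edge of the red path at \<open>p j\<close> is presented.\<close>

context
  fixes p n q m j s
  assumes p: "is_path R p n" and j: "j \<le> n"
    and q: "is_path {f \<in> B. t f < s} q m" and q0: "q 0 = p j"
begin

lemma blue_branch_edge: "i < m \<Longrightarrow> {q i, q (Suc i)} \<in> B \<and> t {q i, q (Suc i)} < s"
  using q by (auto simp: is_path_def)

lemma blue_branch_conn: "i \<le> m \<Longrightarrow> (p j, q i) \<in> conn (R \<union> B - path_edges p n)"
proof -
  have "is_path (R \<union> B - path_edges p n) q m"
    by (rule is_path_mono[OF q]) (use path_edges_subset[OF p] disj in auto)
  then show "i \<le> m \<Longrightarrow> ?thesis"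
    using is_path_conn[of _ q m 0 i] q0 by simp
qed

lemma blue_branch_leaves:
  assumes "1 \<le> i" "i \<le> m" "k \<le> n"
  shows "q i \<noteq> p k"
proof
  assume *: "q i = p k"
  have "q i \<noteq> q 0" using is_path_eq_iff[OF q, of i 0] assms by simp
  then have "j \<noteq> k" using * q0 by auto
  have "is_path (R \<union> B) p n" using p by (rule is_path_mono) simp
  from forest_path_separated[OF forest this j assms(3) \<open>j \<noteq> k\<close>]
  show False using blue_branch_conn[OF assms(2)] * by simp
qed

lemma blue_branch_subset: "path_edges q m \<subseteq> hanging p n j \<inter> B"
proof
  fix f assume "f \<in> path_edges q m"
  then obtain i where i: "i < m" "f = {q i, q (Suc i)}" by (auto simp: path_edges_def)
  then have "f \<in> B" "f \<notin> path_edges p n"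
    using blue_branch_edge path_edges_subset[OF p] disj by auto
  then show "f \<in> hanging p n j \<inter> B"
    using blue_branch_conn[of i] i by (auto simp: component_edges_conn)
qed

text \<open>By \<open>blueD\<close> the blue edge has an earlier red neighbour \<open>g\<close>.
  Such a \<open>g\<close> can lie on \<open>p\<close> only if it contains \<open>q 0\<close>, hence
  only for \<open>i = 0\<close>. There the timing hypothesis excludes it, because \<open>g\<close>
  is older than the blue edge, which is older than \<open>s\<close>. Off the path, \<open>g\<close>
  hangs at \<open>p j\<close> together with the branch.\<close>

lemma red_at_blue_branch:
  assumes "i < m" "1 \<le> i \<or> (\<forall>f\<in>path_edges p n. p j \<in> f \<longrightarrow> s \<le> t f)"
  shows "\<exists>g. g \<in> hanging p n j \<inter> R \<and> g \<inter> {q i, q (Suc i)} \<noteq> {}"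
proof -
  let ?e = "{q i, q (Suc i)}"
  obtain g where g: "g \<in> R" "t g < t ?e" "g \<inter> ?e \<noteq> {}"
    using closes_2D[OF blueD] blue_branch_edge[OF assms(1)] by blast
  have "g \<notin> path_edges p n"
  proof
    assume gp: "g \<in> path_edges p n"
    then obtain i' where i': "i' < n" "g = {p i', p (Suc i')}" by (auto simp: path_edges_def)
    then have on: "\<exists>k\<le>n. x = p k" if "x \<in> g" for x
      using that by (cases "x = p i'") (auto intro: exI[of _ i'] exI[of _ "Suc i'"])
    then have off: "q k \<notin> g" if "1 \<le> k" "k \<le> m" for k
      using blue_branch_leaves that by blast
    then have "q i \<in> g" using g(3) assms(1) off[of "Suc i"] by auto
    moreover from this have "i = 0" using off[of i] assms(1) by (cases i) auto
    ultimately have "i = 0" "q 0 \<in> g" by auto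
    then have "s \<le> t g" using assms(2) gp q0 by auto
    then show False using g(2) blue_branch_edge[OF assms(1)] by simp
  qed
  moreover obtain k where "k \<le> m" "q k \<in> g" using g(3) assms(1) by fastforce
  ultimately have "g \<in> hanging p n j"
    using g(1) blue_branch_conn by (auto simp: component_edges_conn)
  then show ?thesis using g by blast
qed

lemma card_hanging_split: "m + card (hanging p n j \<inter> R) \<le> card (hanging p n j)"
proof -
  have "m + card (hanging p n j \<inter> R) \<le> card (hanging p n j \<inter> B) + card (hanging p n j \<inter> R)"
    using card_mono[OF _ blue_branch_subset] card_path_edges[OF q] finite_hanging by fastforce
  also have "\<dots> = card (hanging p n j \<inter> B \<union> hanging p n j \<inter> R)"
    by (rule card_Un_disjoint[symmetric]) (use finite_hanging disj in auto)
  also have "\<dots> \<le> card (hanging p n j)" by (intro card_mono finite_hanging) auto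
  finally show ?thesis .
qed

text \<open>The second blue edge has no vertex on \<open>p\<close>, so its red neighbour is a
  further hanging edge.\<close>

lemma card_hanging_branch: "2 \<le> m \<Longrightarrow> m + 1 \<le> card (hanging p n j)"
proof -
  assume "2 \<le> m"
  then obtain g where "g \<in> hanging p n j \<inter> R" using red_at_blue_branch[of 1] by auto
  then have "1 \<le> card (hanging p n j \<inter> R)"
    using finite_hanging by (metis One_nat_def Suc_leI card_gt_0_iff empty_iff finite_Int)
  then show ?thesis using card_hanging_split by linarith
qed

text \<open>If the branch is older than the red path edges at \<open>p j\<close>, its first edge has
  a hanging red neighbour too. The red neighbours of the first and of the third blue edge are
  different, since a common one would close a cycle with the branch. So there are three blue and two
  red edges.\<close>

lemma card_hanging_branch_early:
  assumes "m = 3" "\<forall>f\<in>path_edges p n. p j \<in> f \<longrightarrow> s \<le> t f"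
  shows "5 \<le> card (hanging p n j)"
proof -
  obtain g where g: "g \<in> hanging p n j \<inter> R" "g \<inter> {q 0, q 1} \<noteq> {}"
    using red_at_blue_branch[of 0] assms by auto
  obtain h where h: "h \<in> hanging p n j \<inter> R" "h \<inter> {q 2, q 3} \<noteq> {}"
    using red_at_blue_branch[of 2] assms by (auto simp: numeral_3_eq_3)
  have "g \<noteq> h"
  proof
    assume "g = h"
    then obtain x y where xy: "q x \<in> g" "q y \<in> g" "x \<le> 1" "2 \<le> y" "y \<le> 3"
      using g(2) h(2) by fastforce
    then have ne: "q x \<noteq> q y" using is_path_eq_iff[OF q, of x y] assms(1) by auto
    have "g = {q x, q y}"
      using card2[of g] g(1) xy(1,2) ne by (auto simp: card_2_iff)
    moreover have "(q x, q y) \<in> conn (R \<union> B - {g})"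
    proof (rule is_path_conn)
      show "is_path (R \<union> B - {g}) q m"
        by (rule is_path_mono[OF q]) (use g(1) disj in auto)
    qed (use xy assms(1) in auto)
    ultimately show False
      using forest_bridge[OF forest, of "q x" "q y"] g(1) ne by auto
  qed
  then have "2 = card {g, h}" by simp
  also have "\<dots> \<le> card (hanging p n j \<inter> R)"
    by (intro card_mono) (use finite_hanging g h in auto)
  finally show ?thesis using card_hanging_split assms(1) by linarith
qed

end

lemma card_hanging:
  assumes "is_path R p n" "j \<le> n" "path_from {f \<in> B. t f < s} (p j) m"
  shows "m \<le> card (hanging p n j)" "2 \<le> m \<Longrightarrow> m + 1 \<le> card (hanging p n j)"
    "m = 3 \<Longrightarrow> \<forall>f\<in>path_edges p n. p j \<in> f \<longrightarrow> s \<le> t f \<Longrightarrow> 5 \<le> card (hanging p n j)"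
proof -
  obtain q where q: "is_path {f \<in> B. t f < s} q m" "q 0 = p j"
    using assms(3) by (auto simp: path_from_def)
  note * = assms(1,2) q
  show "m \<le> card (hanging p n j)" using card_hanging_split[OF *] by simp
  show "2 \<le> m \<Longrightarrow> m + 1 \<le> card (hanging p n j)" by (rule card_hanging_branch[OF *])
  show "m = 3 \<Longrightarrow> \<forall>f\<in>path_edges p n. p j \<in> f \<longrightarrow> s \<le> t f \<Longrightarrow> 5 \<le> card (hanging p n j)"
    by (rule card_hanging_branch_early[OF *])
qed

text \<open>The edge could not be blue without completing a blue path with four edges. By
  \<open>redD\<close> this is the only circumstance in which Painter extends a red edge by another
  red one.\<close>

definition forced :: "(nat \<Rightarrow> 'v) \<Rightarrow> nat \<Rightarrow> bool" where
  "forced p j \<longleftrightarrow> closes {f \<in> B. t f < t {p j, p (Suc j)}} {p j, p (Suc j)} 4"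

text \<open>The blue paths at the two ends have three edges in total, so one of them has at least
  two and brings a red edge with it.\<close>

lemma forced_pair:
  assumes "is_path R p n" "j < n" "forced p j"
  shows "4 \<le> card (hanging p n j) + card (hanging p n (Suc j))"
proof -
  obtain a b where ab: "path_from {f \<in> B. t f < t {p j, p (Suc j)}} (p j) a"
    "path_from {f \<in> B. t f < t {p j, p (Suc j)}} (p (Suc j)) b" "Suc (a + b) = 4"
    using assms(3) unfolding forced_def by (rule closesE)
  have "j \<le> n" "Suc j \<le> n" using assms(2) by auto
  note a = card_hanging[OF assms(1) this(1) ab(1)] and b = card_hanging[OF assms(1) this(2) ab(2)]
  have "2 \<le> a \<or> 2 \<le> b" using ab(3) by linarith
  then show ?thesis using a b ab(3) by linarith
qed

text \<open>With at most four edges in total, \<open>forced_pair\<close> for both path edges leaves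
  the outer two vertices without any hanging edge. Then both path edges are forced by blue paths of
  length three at the middle vertex.\<close>

lemma forced_triple:
  assumes "is_path R p n" "Suc j < n" "forced p j" "forced p (Suc j)"
  shows "5 \<le> card (hanging p n j) + card (hanging p n (Suc j)) + card (hanging p n (Suc (Suc j)))"
proof (rule ccontr)
  assume less: "\<not> ?thesis"
  let ?h = "\<lambda>i. card (hanging p n i)" and ?e = "{p j, p (Suc j)}"
    and ?f = "{p (Suc j), p (Suc (Suc j))}"
  have le: "j \<le> n" "Suc j \<le> n" "Suc (Suc j) \<le> n" using assms(2) by auto
  have "4 \<le> ?h j + ?h (Suc j)" "4 \<le> ?h (Suc j) + ?h (Suc (Suc j))"
    using forced_pair[OF assms(1) _ assms(3)] forced_pair[OF assms(1) _ assms(4)] assms(2) by auto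
  then have 0: "?h j = 0" "?h (Suc (Suc j)) = 0" "?h (Suc j) \<le> 4" using less by linarith+
  obtain a b where ab: "path_from {f \<in> B. t f < t ?e} (p j) a"
    "path_from {f \<in> B. t f < t ?e} (p (Suc j)) b" "Suc (a + b) = 4"
    using assms(3) unfolding forced_def by (rule closesE)
  obtain a' b' where ab': "path_from {f \<in> B. t f < t ?f} (p (Suc j)) a'"
    "path_from {f \<in> B. t f < t ?f} (p (Suc (Suc j))) b'" "Suc (a' + b') = 4"
    using assms(4) unfolding forced_def by (rule closesE)
  have "a = 0" "b' = 0"
    using card_hanging(1)[OF assms(1) le(1) ab(1)] card_hanging(1)[OF assms(1) le(3) ab'(2)] 0
    by auto
  then have 3: "path_from {f \<in> B. t f < t ?e} (p (Suc j)) 3"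
    "path_from {f \<in> B. t f < t ?f} (p (Suc j)) 3"
    using ab ab' by (auto simp: numeral_eq_Suc)
  \<comment> \<open>The blue path that forced the earlier of the two red edges is older than both.
    So \<open>card_hanging\<close> gives five edges at the middle vertex instead of four.\<close>
  have "path_from {f \<in> B. t f < min (t ?e) (t ?f)} (p (Suc j)) 3"
    using 3 by (cases "t ?e \<le> t ?f") (auto simp: min_def)
  moreover have "\<forall>f\<in>path_edges p n. p (Suc j) \<in> f \<longrightarrow> min (t ?e) (t ?f) \<le> t f"
  proof (intro ballI impI)
    fix f assume "f \<in> path_edges p n" "p (Suc j) \<in> f"
    then obtain i where i: "i < n" "f = {p i, p (Suc i)}" "p (Suc j) = p i \<or> p (Suc j) = p (Suc i)"
      by (auto simp: path_edges_def)
    then have "Suc j = i \<or> j = i"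
      using is_path_eq_iff[OF assms(1), of "Suc j" i] is_path_eq_iff[OF assms(1), of "Suc j" "Suc i"] le
      by auto
    then show "min (t ?e) (t ?f) \<le> t f" using i(2) by auto
  qed
  ultimately have "5 \<le> ?h (Suc j)"
    using card_hanging(3)[OF assms(1) le(2)] by blast
  then show False using 0 by simp
qed

text \<open>The later of the two edges closed a red path with two edges when it was
  presented.\<close>

lemma forced_or_forced:
  assumes "is_path R p n" "Suc j < n"
  shows "forced p j \<or> forced p (Suc j)"
proof -
  let ?e = "{p j, p (Suc j)}" and ?f = "{p (Suc j), p (Suc (Suc j))}"
  have R: "?e \<in> R" "?f \<in> R" using assms by (auto simp: is_path_def)
  have "?e \<noteq> ?f"
    using path_edge_inj[of p n j "Suc j"] assms by (auto simp: is_path_def)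
  then consider "t ?e < t ?f" | "t ?f < t ?e"
    using R inj_t by (metis (no_types, lifting) UnI1 inj_onD nat_neq_iff)
  then show ?thesis
  proof cases
    case 1
    have "is_path R (\<lambda>i. p (j + 2 - i)) 2" using is_path_rev[OF assms(1)] assms(2) by simp
    then have "closes {g \<in> R. t g < t ?f} {p (j + 2 - 0), p (j + 2 - 1)} 2"
      by (rule closes_2I) (use 1 R in \<open>auto simp: insert_commute\<close>)
    then have "closes {g \<in> R. t g < t ?f} ?f 2" by (simp add: insert_commute)
    then show ?thesis using redD[OF R(2)] by (simp add: forced_def)
  next
    case 2
    have "is_path R (\<lambda>i. p (j + i)) 2" using is_path_shift[OF assms(1)] assms(2) by simp
    then have "closes {g \<in> R. t g < t ?e} {p (j + 0), p (j + 1)} 2"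
      by (rule closes_2I) (use 2 R in auto)
    then have "closes {g \<in> R. t g < t ?e} ?e 2" by simp
    then show ?thesis using redD[OF R(1)] by (simp add: forced_def)
  qed
qed

text \<open>Each vertex is weighted by its hanging tree. Vertex 0 is left out because in
  \<open>hanging_blue_path\<close> the red path starts on a blue path, whose edges all hang
  there.\<close>

lemma hanging_red_path:
  assumes "is_path R p n"
  shows "5 * n \<le> 3 * (\<Sum>j = 1..n. card (hanging p n j)) + 15"
proof -
  have "5 * (Suc n - 1) \<le> 3 * (\<Sum>j = 1..<Suc n. card (hanging p n j)) + 15"
    by (rule block_sum[where F = "forced p"])
      (use forced_or_forced[OF assms] forced_pair[OF assms] forced_triple[OF assms] in auto)
  then show ?thesis by (simp add: atLeastLessThanSuc_atLeastAtMost)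
qed

section \<open>Trees hanging at the vertices of a blue path\<close>

lemma hanging_blue_path:
  assumes p: "is_path B p n" and i: "i \<le> n" and "path_from R (p i) x"
  shows "8 * x \<le> 3 * card (hanging p n i) + 15"
proof -
  obtain q where q: "is_path R q x" and q0: "q 0 = p i" using assms(3) by (auto simp: path_from_def)
  let ?D = "path_edges p n" and ?Q = "path_edges q x"
  have D: "?D \<subseteq> B" and Q: "?Q \<subseteq> R" using p q by (auto dest: path_edges_subset)
  have q': "is_path (R \<union> B) q x" using q by (rule is_path_mono) simp
  have conn_q: "(p i, q k) \<in> conn (R \<union> B - ?D)" if "k \<le> x" for k
  proof -
    have "is_path (R \<union> B - ?D) q x" by (rule is_path_mono[OF q]) (use D disj in auto)
    from is_path_conn[OF this, of 0 k] show ?thesis using that q0 by simp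
  qed
  have Q_sub: "?Q \<subseteq> hanging p n i"
  proof
    fix f assume f: "f \<in> ?Q"
    then obtain k where "k < x" "f = {q k, q (Suc k)}" by (auto simp: path_edges_def)
    then show "f \<in> hanging p n i"
      using conn_q[of k] f Q D disj by (auto simp: component_edges_conn)
  qed
  \<comment> \<open>Seen from the red path \<open>q\<close>, the whole blue path is part of the tree
    at its starting vertex.\<close>
  have D_sub: "?D \<subseteq> hanging q x 0"
  proof
    fix f assume f: "f \<in> ?D"
    then obtain k where k: "k < n" "f = {p k, p (Suc k)}" by (auto simp: path_edges_def)
    have "is_path (R \<union> B - ?Q) p n" by (rule is_path_mono[OF p]) (use Q disj in auto)
    from is_path_conn[OF this i, of k] show "f \<in> hanging q x 0"
      using k q0 f Q D disj by (auto simp: component_edges_conn)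
  qed
  \<comment> \<open>The trees at the other vertices of \<open>q\<close> are disjoint from that one.
    They avoid the blue path and remain connected to \<open>p i\<close> when its edges are deleted
    instead of those of \<open>q\<close>.\<close>
  have K_sub: "hanging q x j \<subseteq> hanging p n i" if "1 \<le> j" "j \<le> x" for j
  proof
    fix f assume f: "f \<in> hanging q x j"
    have no_D: "hanging q x j \<inter> ?D = {}"
      using hanging_disjoint[OF q', of 0 j] that D_sub by auto
    obtain u where u: "u \<in> f" "(q j, u) \<in> conn (R \<union> B - ?Q)"
      using f by (auto simp: component_edges_conn)
    have "(q j, u) \<in> conn (R \<union> B - ?D)"
      using conn_Diff[OF u(2) no_D] by (rule conn_mono) auto
    then have "(p i, u) \<in> conn (R \<union> B - ?D)" using conn_q[OF that(2)] conn_trans by metis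
    moreover have "f \<in> R \<union> B - ?D" using f no_D by (auto simp: component_edges_conn)
    ultimately show "f \<in> hanging p n i" using u(1) by (auto simp: component_edges_conn)
  qed
  have "x + (\<Sum>j = 1..x. card (hanging q x j)) = card ?Q + card (\<Union>j\<in>{1..x}. hanging q x j)"
    using card_path_edges[OF q] hanging_disjoint[OF q'] finite_hanging
    by (subst card_UN_disjoint) auto
  also have "\<dots> = card (?Q \<union> (\<Union>j\<in>{1..x}. hanging q x j))"
    by (rule card_Un_disjoint[symmetric])
      (use finite_hanging in \<open>auto simp: path_edges_def component_edges_def\<close>)
  also have "\<dots> \<le> card (hanging p n i)"
    by (intro card_mono finite_hanging Un_least UN_least Q_sub K_sub) auto
  \<comment> \<open>The \<open>x\<close> edges of \<open>q\<close> contribute \<open>3 * x\<close>,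
    the trees along \<open>q\<close> contribute \<open>5 * x - 15\<close>.\<close>
  finally show ?thesis using hanging_red_path[OF q] by linarith
qed

lemma no_red_path:
  assumes "1 \<le> l"
  shows "\<not> is_path R p l"
proof
  assume p: "is_path R p l"
  have "inj_on t R" using inj_t by (rule inj_on_subset) simp
  from path_last_edge_closes[OF p assms this] obtain i where
    "i < l" "closes {f \<in> R. t f < t {p i, p (Suc i)}} {p i, p (Suc i)} l" by blast
  then show False using red_lD[of "{p i, p (Suc i)}"] p by (auto simp: is_path_def)
qed

text \<open>The \<open>l + 1\<close> vertices are grouped by fives. Among the four edges within a
  group, the last one presented closed a blue path with four edges. By \<open>blue4D\<close> there
  are then red paths of total length \<open>l - 1\<close> at its ends, and
  \<open>hanging_blue_path\<close> at these two vertices gives \<open>8 * (l - 1)\<close> with a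
  loss of 15 each.\<close>

lemma blue_path_component:
  assumes p: "is_path B p l"
  shows "8 * (l - 1) * ((l + 1) div 5) \<le> 3 * card (component_edges (R \<union> B) (p 0)) + 30 * ((l + 1) div 5)"
proof -
  let ?h = "\<lambda>i. card (hanging p l i)"
  have p': "is_path (R \<union> B) p l" using p by (rule is_path_mono) simp
  have block: "8 * (l - 1) \<le> 3 * (\<Sum>i<5. ?h (5 * b + i)) + 30" if b: "5 * b + 4 \<le> l" for b
  proof -
    have "inj_on t B" using inj_t by (rule inj_on_subset) simp
    then obtain i where i: "i < 4" and c:
      "closes {f \<in> B. t f < t {p (5 * b + i), p (5 * b + Suc i)}} {p (5 * b + i), p (5 * b + Suc i)} 4"
      using path_last_edge_closes[OF is_path_shift[OF p b]] by auto
    have "{p (5 * b + i), p (5 * b + Suc i)} \<in> B" using p i b by (auto simp: is_path_def)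
    from blue4D[OF this c] obtain x y where xy:
      "path_from {f \<in> R. t f < t {p (5 * b + i), p (5 * b + Suc i)}} (p (5 * b + i)) x"
      "path_from {f \<in> R. t f < t {p (5 * b + i), p (5 * b + Suc i)}} (p (5 * b + Suc i)) y"
      "Suc (x + y) = l"
      by (rule closesE)
    have "path_from R (p (5 * b + i)) x" "path_from R (p (5 * b + Suc i)) y"
      using xy by (auto elim: path_from_mono)
    then have "8 * x \<le> 3 * ?h (5 * b + i) + 15" "8 * y \<le> 3 * ?h (5 * b + Suc i) + 15"
      using hanging_blue_path[OF p] i b by auto
    moreover have "?h (5 * b + i) + ?h (5 * b + Suc i) = (\<Sum>i\<in>{i, Suc i}. ?h (5 * b + i))" by simp
    moreover have "\<dots> \<le> (\<Sum>i<5. ?h (5 * b + i))" by (rule sum_mono2) (use i in auto)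
    ultimately show ?thesis using xy(3) by linarith
  qed
  have sum: "N * (8 * (l - 1)) \<le> 3 * (\<Sum>i<5 * N. ?h i) + 30 * N" if "5 * N \<le> l + 1" for N
    using that
  proof (induction N)
    case (Suc N)
    have "(\<Sum>i<5 * Suc N. ?h i) = (\<Sum>i<5 * N. ?h i) + (\<Sum>i<5. ?h (5 * N + i))"
      by (simp add: numeral_eq_Suc)
    then show ?case using Suc block[of N] by (simp add: algebra_simps)
  qed simp
  have "(\<Sum>i<5 * ((l + 1) div 5). ?h i) \<le> (\<Sum>i\<le>l. ?h i)"
    by (rule sum_mono2) (auto simp: less_Suc_eq_le[symmetric])
  also have "\<dots> = card (\<Union>i\<in>{..l}. hanging p l i)"
    using hanging_disjoint[OF p'] finite_hanging by (subst card_UN_disjoint) auto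
  also have "\<dots> \<le> card (component_edges (R \<union> B) (p 0))"
  proof (rule card_mono)
    show "finite (component_edges (R \<union> B) (p 0))"
      by (rule finite_subset[OF _ fin]) (auto simp: component_edges_def)
    show "(\<Union>i\<in>{..l}. hanging p l i) \<subseteq> component_edges (R \<union> B) (p 0)"
    proof
      fix f assume "f \<in> (\<Union>i\<in>{..l}. hanging p l i)"
      then obtain i u where i: "i \<le> l" "f \<in> R \<union> B" "u \<in> f" "(p i, u) \<in> conn (R \<union> B - path_edges p l)"
        by (auto simp: component_edges_conn)
      then have "(p 0, u) \<in> conn (R \<union> B)"
        using is_path_conn[OF p', of 0 i] by (meson Diff_subset conn_mono conn_trans le0)
      then show "f \<in> component_edges (R \<union> B) (p 0)"
        using i by (auto simp: component_edges_conn)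
    qed
  qed
  finally show ?thesis using sum[of "(l + 1) div 5"] by (simp add: algebra_simps)
qed

end

section \<open>Painter's strategy\<close>

definition paint :: "nat \<Rightarrow> 'v set set \<Rightarrow> 'v set set \<Rightarrow> 'v set \<Rightarrow> nat" where
  "paint l R B e =
    (if \<not> closes R e 2 then 0 else if \<not> closes B e 4 then 1 else if \<not> closes R e l then 0 else 1)"

text \<open>A position does not record the order of the moves. The time stamps \<open>t\<close>
  restore it, so that each color can be compared with the rule applied to the earlier edges.\<close>

definition painted :: "nat \<Rightarrow> (nat set \<Rightarrow> nat) \<Rightarrow> position \<Rightarrow> bool" where
  "painted l t s \<longleftrightarrow> inj_on t (dom s) \<and>
    (\<forall>e\<in>dom s. s e = Some (paint l {f. s f = Some 0 \<and> t f < t e} {f. s f = Some 1 \<and> t f < t e} e))"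

definition valid :: "nat \<Rightarrow> nat \<Rightarrow> position \<Rightarrow> bool" where
  "valid a k s \<longleftrightarrow> (\<forall>e\<in>dom s. e \<subseteq> {..<a} \<and> card e = 2) \<and> is_forest (dom s) \<and>
    (\<forall>v<a. card (component_edges (dom s) v) \<le> k)"

lemma valid_finite: "valid a k s \<Longrightarrow> finite (dom s)"
  by (rule finite_subset[of _ "Pow {..<a}"]) (auto simp: valid_def)

lemma valid_move: "valid a k s \<Longrightarrow> legal_move a k s e \<Longrightarrow> valid a k (s(e \<mapsto> c))"
  by (auto simp: valid_def legal_move_def)

lemma is_forest_empty [simp]: "is_forest {}"
proof -
  have "\<not> is_cycle {} vs" for vs :: "'a list"
    unfolding is_cycle_def by (metis empty_iff length_greater_0_conv list.size(3) not_numeral_le_zero)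
  then show ?thesis by (simp add: is_forest_def)
qed

lemma valid_empty: "valid a k Map.empty"
  by (simp add: valid_def component_edges_def)

lemma painted_move:
  assumes "painted l t s" "finite (dom s)" "e \<notin> dom s"
  shows "\<exists>c<2. \<exists>t'. painted l t' (s(e \<mapsto> c))"
proof -
  \<comment> \<open>A time stamp later than all earlier ones; the inserted 0 covers the empty
    position. As the new edge comes last, the rule for the old edges refers to the same sets as
    before.\<close>
  define T where "T = Suc (Max (insert 0 (t ` dom s)))"
  have T: "t f < T" if "f \<in> dom s" for f
    using that assms(2) by (auto simp: T_def less_Suc_eq_le intro: Max_ge)
  define t' where "t' = t(e := T)"
  define c where "c = paint l {f. s f = Some 0} {f. s f = Some 1} e"
  let ?s = "s(e \<mapsto> c)"
  have new: "{f. ?s f = Some x \<and> t' f < t' e} = {f. s f = Some x}" for x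
    using T assms(3) by (auto simp: t'_def)
  have old: "{f. ?s f = Some x \<and> t' f < t' g} = {f. s f = Some x \<and> t f < t g}" if "g \<in> dom s" for x g
    using T[OF that] that assms(3) by (auto simp: t'_def)
  have T': "T \<notin> t ` dom s" using T by auto
  then have "inj_on t' (dom s)"
    unfolding t'_def using assms(1) by (intro inj_on_fun_updI) (auto simp: painted_def)
  moreover have "t' ` dom s = t ` dom s" using assms(3) by (intro image_cong) (auto simp: t'_def)
  ultimately have "inj_on t' (insert e (dom s))" using T' assms(3) by (simp add: t'_def)
  then have "inj_on t' (dom ?s)" by simp
  moreover have "?s g = Some (paint l {f. ?s f = Some 0 \<and> t' f < t' g} {f. ?s f = Some 1 \<and> t' f < t' g} g)"
    if "g \<in> dom ?s" for g
  proof (cases "g = e")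
    case True
    then show ?thesis using new by (simp add: c_def)
  next
    case False
    then have g: "g \<in> dom s" using that by simp
    then show ?thesis
      unfolding old[OF g] using assms(1) False by (simp add: painted_def)
  qed
  moreover have "c < 2" by (simp add: c_def paint_def)
  ultimately show ?thesis unfolding painted_def by blast
qed

lemma mono_copy_imp_path:
  assumes "has_mono_copy (path_graph l) r a s"
  shows "\<exists>c<r. \<exists>f. is_path {e. s e = Some c} f l \<and> (\<forall>i\<le>l. f i < a)"
proof -
  obtain c f where c: "c < r" and f: "inj_on f {0..l}" "f ` {0..l} \<subseteq> {..<a}"
    "\<And>e. e \<in> snd (path_graph l) \<Longrightarrow> s (f ` e) = Some c"
    using assms by (auto simp: has_mono_copy_def path_graph_def)
  have "s {f i, f (Suc i)} = Some c" if "i < l" for i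
    using f(3)[of "{i, Suc i}"] that by (auto simp: path_graph_def)
  then have "is_path {e. s e = Some c} f l"
    using f(1) by (auto simp: is_path_def atLeast0AtMost)
  moreover have "\<forall>i\<le>l. f i < a" using f(2) by (simp add: image_subset_iff)
  ultimately show ?thesis using c by blast
qed

lemma painted_copy_bound:
  assumes "painted l t s" "valid a k s" "2 \<le> l" "has_mono_copy (path_graph l) 2 a s"
  shows "8 * (l - 1) * ((l + 1) div 5) \<le> 3 * k + 30 * ((l + 1) div 5)"
proof -
  define R where "R = {e. s e = Some 0}"
  define B where "B = {e. s e = Some 1}"
  have eqs: "{f. s f = Some 0 \<and> t f < t e} = {f \<in> R. t f < t e}"
    "{f. s f = Some 1 \<and> t f < t e} = {f \<in> B. t f < t e}" for e
    by (auto simp: R_def B_def)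
  have rule: "s e = Some (paint l {f \<in> R. t f < t e} {f \<in> B. t f < t e} e)" if "e \<in> dom s" for e
    using assms(1) that unfolding painted_def eqs by blast
  have "x = 0 \<or> x = 1" if "s e = Some x" for e x
  proof -
    have "e \<in> dom s" using that by auto
    from rule[OF this] that show ?thesis by (simp add: paint_def split: if_splits)
  qed
  then have dom: "R \<union> B = dom s" by (auto simp: R_def B_def)
  have red: "paint l {f \<in> R. t f < t e} {f \<in> B. t f < t e} e = 0" if "e \<in> R" for e
  proof -
    have e: "s e = Some 0" using that by (simp add: R_def)
    then have "e \<in> dom s" by (rule domI)
    from rule[OF this] e show ?thesis by (simp only: option.inject)
  qed
  have blue: "paint l {f \<in> R. t f < t e} {f \<in> B. t f < t e} e = 1" if "e \<in> B" for e
  proof -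
    have e: "s e = Some 1" using that by (simp add: B_def)
    then have "e \<in> dom s" by (rule domI)
    from rule[OF this] e show ?thesis by (simp only: option.inject)
  qed
  interpret painted_forest R B t l
  proof
    show "finite (R \<union> B)" "is_forest (R \<union> B)" "inj_on t (R \<union> B)"
      using assms(1,2) valid_finite unfolding dom by (auto simp: painted_def valid_def)
    show "card e = 2" if "e \<in> R \<union> B" for e
      using assms(2) that unfolding dom by (simp add: valid_def)
    show "R \<inter> B = {}" by (auto simp: R_def B_def)
    show "closes {f \<in> R. t f < t e} e 2" if "e \<in> B" for e
      using blue[OF that] by (auto simp: paint_def split: if_splits)
    show "closes {f \<in> B. t f < t e} e 4" if "e \<in> R" "closes {f \<in> R. t f < t e} e 2" for e
      using red[OF that(1)] that(2) by (auto simp: paint_def split: if_splits)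
    show "closes {f \<in> R. t f < t e} e l" if "e \<in> B" "closes {f \<in> B. t f < t e} e 4" for e
      using blue[OF that(1)] that(2) by (auto simp: paint_def split: if_splits)
    \<comment> \<open>An edge that is red by the first test of \<open>paint\<close> does not close a
      red path with two edges, hence by \<open>closes_le\<close> none with \<open>l\<close>
      edges.\<close>
    show "\<not> closes {f \<in> R. t f < t e} e l" if "e \<in> R" for e
      using red[OF that] closes_le[of _ e l 2] assms(3) by (auto simp: paint_def split: if_splits)
  qed
  obtain c p where p: "c < 2" "is_path {e. s e = Some c} p l" "\<forall>i\<le>l. p i < a"
    using mono_copy_imp_path[OF assms(4)] by blast
  then have "is_path R p l \<or> is_path B p l"
    by (auto simp: R_def B_def less_2_cases_iff)
  then have "is_path B p l" using no_red_path assms(3) by auto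
  moreover have "card (component_edges (R \<union> B) (p 0)) \<le> k"
    using assms(2) p(3) unfolding dom by (simp add: valid_def)
  ultimately show ?thesis using blue_path_component by fastforce
qed

section \<open>The quadratic lower bound\<close>

lemma builder_forces_bound:
  assumes "builder_forces (path_graph l) 2 a k s" "painted l t s" "valid a k s" "2 \<le> l"
  shows "8 * (l - 1) * ((l + 1) div 5) \<le> 3 * k + 30 * ((l + 1) div 5)"
  using assms
proof (induction arbitrary: t rule: builder_forces.induct)
  case (copy s)
  then show ?case using painted_copy_bound by blast
next
  \<comment> \<open>Of the two positions after the move, the induction follows the one in which
    Painter has obeyed the rule.\<close>
  case (move s e)
  have "e \<notin> dom s" using move.hyps(1) by (simp add: legal_move_def)
  from painted_move[OF move.prems(1) valid_finite[OF move.prems(2)] this] obtain c t' where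
    "c < 2" "painted l t' (s(e \<mapsto> c))" by blast
  then show ?case
    using move.IH[of c t'] valid_move[OF move.prems(2) move.hyps(1)] move.prems(3) by blast
qed

lemma builder_wins_bound:
  assumes "builder_wins (path_graph l) 2 k" "5 \<le> l"
  shows "8 / 15 * (real l)\<^sup>2 - 5 * real l \<le> real k"
proof -
  define N where "N = (l + 1) div 5"
  have "8 * (l - 1) * N \<le> 3 * k + 30 * N"
  proof -
    obtain a where a: "builder_forces (path_graph l) 2 a k Map.empty"
      using assms(1) by (auto simp: builder_wins_def)
    have "painted l (\<lambda>_. 0) Map.empty" by (simp add: painted_def)
    from builder_forces_bound[OF a this valid_empty] assms(2) show ?thesis by (simp add: N_def)
  qed
  then have "real (8 * (l - 1) * N) \<le> real (3 * k + 30 * N)" by (simp only: of_nat_le_iff)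
  then have 1: "(8 * real l - 38) * real N \<le> 3 * real k"
    using assms(2) by (simp add: of_nat_diff algebra_simps)
  \<comment> \<open>Fewer than five vertices are left over by the grouping. The factor
    \<open>8 * l - 38\<close>, which is \<open>8 * (l - 1) - 30\<close>, is positive from
    \<open>l = 5\<close> on.\<close>
  have "l \<le> 5 * N + 3" unfolding N_def by linarith
  then have "real l \<le> 5 * real N + 3" by linarith
  then have "(8 * real l - 38) * (real l - 3) \<le> (8 * real l - 38) * (5 * real N)"
    using assms(2) by (intro mult_left_mono) auto
  with 1 have "(8 * real l - 38) * (real l - 3) \<le> 15 * real k" by simp
  then show ?thesis by (simp add: power2_eq_square algebra_simps)
qed

section \<open>Joining separated components\<close>

text \<open>No edge leaves \<open>V\<close>, that is, \<open>V\<close> is a union of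
  components.\<close>

definition separated :: "'v set set \<Rightarrow> 'v set \<Rightarrow> bool" where
  "separated E V \<longleftrightarrow> (\<forall>f\<in>E. f \<subseteq> V \<or> f \<inter> V = {})"

lemma separated_conn:
  assumes "(x, y) \<in> conn E" "separated E V"
  shows "x \<in> V \<longleftrightarrow> y \<in> V"
  using assms(1) by (induction rule: conn_induct) (use assms(2) in \<open>auto simp: separated_def\<close>)

text \<open>A cycle in the larger graph uses the new edge, and exactly once. The rest of the cycle
  then connects \<open>u\<close> and \<open>v\<close> in \<open>E\<close>.\<close>

lemma forest_insert:
  assumes "is_forest E" "(u, v) \<notin> conn E"
  shows "is_forest (insert {u, v} E)"
  unfolding is_forest_def
proof (rule notI, erule exE)
  fix vs assume cyc: "is_cycle (insert {u, v} E) vs"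
  define n where "n = length vs"
  have n: "3 \<le> n" and dist: "distinct vs"
    using cyc by (auto simp: is_cycle_def n_def)
  have edge: "{vs ! i, vs ! (Suc i mod n)} \<in> insert {u, v} E" if "i < n" for i
    using cyc that by (auto simp: is_cycle_def n_def)
  obtain i where i: "i < n" "{vs ! i, vs ! (Suc i mod n)} = {u, v}"
  proof -
    have "\<not> is_cycle E vs" using assms(1) by (simp add: is_forest_def)
    then have "\<not> (\<forall>i<n. {vs ! i, vs ! (Suc i mod n)} \<in> E)"
      using n dist by (simp add: is_cycle_def n_def)
    then obtain i where "i < n" "{vs ! i, vs ! (Suc i mod n)} \<notin> E" by blast
    then show ?thesis using that edge[of i] by simp
  qed
  have eq: "vs ! x = vs ! y \<longleftrightarrow> x = y" if "x < n" "y < n" for x y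
    using dist that by (simp add: n_def nth_eq_iff_index_eq)
  have other: "{vs ! k, vs ! (Suc k mod n)} \<in> E" if "k < n" "k \<noteq> i" for k
  proof -
    have "{vs ! k, vs ! (Suc k mod n)} \<noteq> {vs ! i, vs ! (Suc i mod n)}"
    proof
      assume "{vs ! k, vs ! (Suc k mod n)} = {vs ! i, vs ! (Suc i mod n)}"
      then have "vs ! k = vs ! i \<or> vs ! k = vs ! (Suc i mod n) \<and> vs ! (Suc k mod n) = vs ! i"
        unfolding doubleton_eq_iff by blast
      \<comment> \<open>The same edge at two positions would have to be traversed in opposite
        directions, which requires a cycle of length two.\<close>
      then have *: "k = Suc i mod n \<and> Suc k mod n = i"
      proof -
        have "Suc i mod n < n" "Suc k mod n < n" using n by auto
        with \<open>_ \<or> _\<close> show ?thesis by (metis eq that i(1))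
      qed
      have "Suc x mod n = (if Suc x = n then 0 else Suc x)" if "x < n" for x
        using that by (simp add: mod_Suc)
      from this[OF i(1)] this[OF that(1)] *
      have "k = (if Suc i = n then 0 else Suc i)" "(if Suc k = n then 0 else Suc k) = i"
        by metis+
      then show False using n i(1) that by (simp split: if_splits)
    qed
    then show ?thesis using edge[OF that(1)] i(2) by auto
  qed
  \<comment> \<open>Walk around the cycle from the end of the new edge. The first
    \<open>n - 1\<close> edges of this walk are old, and they lead to its other end
    \<open>vs ! i\<close>.\<close>
  have "(vs ! (Suc i mod n), vs ! ((Suc i + j) mod n)) \<in> conn E" if "j < n" for j
    using that
  proof (induction j)
    case (Suc j)
    let ?k = "(Suc i + j) mod n"
    have "?k \<noteq> i"
    proof
      assume *: "?k = i"
      have "Suc i + j < 2 * n" using Suc.prems i by simp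
      then have "?k = Suc i + j \<or> ?k = Suc i + j - n" by (auto simp: mod_if)
      then show False using * Suc.prems i by auto
    qed
    then have "{vs ! ?k, vs ! (Suc ?k mod n)} \<in> E" using other n by simp
    then have "(vs ! ?k, vs ! ((Suc i + Suc j) mod n)) \<in> conn E"
      using conn_edge by (fastforce simp: mod_Suc_eq)
    then show ?case using Suc conn_trans by fastforce
  qed simp
  from this[of "n - 1"] have "(vs ! (Suc i mod n), vs ! i) \<in> conn E"
    using n i(1) by simp
  then have "(u, v) \<in> conn E"
    using i(2) by (auto simp: doubleton_eq_iff intro: conn_sym)
  then show False using assms(2) by simp
qed

text \<open>No edge leaves the union of \<open>V\<close> and \<open>W\<close> after the insertion.
  So only components inside this union can grow, and the size restriction needs a new check only
  there.\<close>

lemma component_edges_insert: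
  assumes "separated E V" "separated E W" "v \<in> V" "w \<in> W"
  shows "x \<in> V \<union> W \<Longrightarrow> component_edges (insert {v, w} E) x \<subseteq> {f \<in> insert {v, w} E. f \<subseteq> V \<union> W}"
    and "x \<notin> V \<union> W \<Longrightarrow> component_edges (insert {v, w} E) x \<subseteq> component_edges E x"
proof -
  have sep: "separated (insert {v, w} E) (V \<union> W)"
    using assms by (auto simp: separated_def)
  show "x \<in> V \<union> W \<Longrightarrow> component_edges (insert {v, w} E) x \<subseteq> {f \<in> insert {v, w} E. f \<subseteq> V \<union> W}"
    using sep separated_conn[OF _ sep] unfolding separated_def component_edges_conn by blast
  assume x: "x \<notin> V \<union> W"
  show "component_edges (insert {v, w} E) x \<subseteq> component_edges E x"
  proof
    fix f assume "f \<in> component_edges (insert {v, w} E) x"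
    then obtain u where u: "f \<in> insert {v, w} E" "u \<in> f" "(x, u) \<in> conn (insert {v, w} E)"
      by (auto simp: component_edges_conn)
    have out: "y \<notin> V \<union> W" if "(x, y) \<in> conn (insert {v, w} E)" for y
      using separated_conn[OF that sep] x by blast
    have "(x, u) \<in> conn E"
      using u(3)
    proof (induction rule: conn_induct)
      case (step y z)
      then have "{y, z} \<in> E" using out[OF step.hyps(1)] assms(3,4) by (auto simp: doubleton_eq_iff)
      then show ?case using step conn_edge conn_trans by meson
    qed simp
    moreover have "f \<in> E" using u out assms(3,4) by auto
    ultimately show "f \<in> component_edges E x" using u(2) by (auto simp: component_edges_conn)
  qed
qed

section \<open>Paths across a joining edge\<close>

lemma is_path_in:
  assumes "is_path C p m" "\<And>e. e \<in> C \<Longrightarrow> e \<subseteq> V" "p 0 \<in> V" "i \<le> m"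
  shows "p i \<in> V"
proof (cases i)
  case (Suc j)
  then have "{p j, p (Suc j)} \<in> C" using assms(1,4) by (simp add: is_path_def)
  then show ?thesis using assms(2) Suc by blast
qed (use assms(3) in simp)

lemma path_from_Cons:
  assumes "path_from C v m" "\<And>e. e \<in> C \<Longrightarrow> e \<subseteq> V" "v \<in> V" "w \<notin> V" "C \<subseteq> C'" "{v, w} \<in> C'"
  shows "path_from C' w (Suc m)"
proof -
  obtain p where p: "is_path C p m" "p 0 = v" using assms(1) by (auto simp: path_from_def)
  define r where "r i = (case i of 0 \<Rightarrow> w | Suc i \<Rightarrow> p i)" for i
  have ne: "p i \<noteq> w" if "i \<le> m" for i
    using is_path_in[OF p(1) assms(2) _ that] p(2) assms(3,4) by blast
  have "inj_on r {..Suc m}"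
  proof (rule inj_onI)
    fix x y assume "x \<in> {..Suc m}" "y \<in> {..Suc m}" "r x = r y"
    then show "x = y"
      using ne[of "x - 1"] ne[of "y - 1"] is_path_eq_iff[OF p(1), of "x - 1" "y - 1"]
      by (cases x; cases y) (simp_all add: r_def)
  qed
  moreover have "{r i, r (Suc i)} \<in> C'" if "i < Suc m" for i
    using that p assms(5,6) by (cases i) (auto simp: r_def is_path_def insert_commute)
  ultimately have "is_path C' r (Suc m)" by (simp add: is_path_def)
  moreover have "r 0 = w" by (simp add: r_def)
  ultimately show ?thesis by (auto simp: path_from_def)
qed

lemma path_from_join:
  assumes v: "path_from C v m" "\<And>e. e \<in> C \<Longrightarrow> e \<subseteq> V" "v \<in> V"
    and w: "path_from D w n" "\<And>e. e \<in> D \<Longrightarrow> e \<subseteq> W" "w \<in> W"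
    and "V \<inter> W = {}" "C \<subseteq> C'" "D \<subseteq> C'" "{v, w} \<in> C'"
  shows "\<exists>x\<in>V. path_from C' x (m + n + 1)"
proof -
  obtain p where p: "is_path C p m" "p 0 = v" using v(1) by (auto simp: path_from_def)
  obtain q where q: "is_path D q n" "q 0 = w" using w(1) by (auto simp: path_from_def)
  have pV: "p i \<in> V" if "i \<le> m" for i using is_path_in[OF p(1) v(2) _ that] p(2) v(3) by blast
  have qW: "q i \<in> W" if "i \<le> n" for i using is_path_in[OF q(1) w(2) _ that] q(2) w(3) by blast
  \<comment> \<open>First \<open>p\<close> backwards from its far end to \<open>v\<close>, then
    across the new edge and along \<open>q\<close>. The far end of \<open>p\<close> is the end found
    in \<open>V\<close>.\<close>
  define r where "r i = (if i \<le> m then p (m - i) else q (i - Suc m))" for i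
  have "inj_on r {..m + n + 1}"
  proof (rule inj_onI)
    fix x y assume xy: "x \<in> {..m + n + 1}" "y \<in> {..m + n + 1}" "r x = r y"
    have ne: "p i \<noteq> q j" if "i \<le> m" "j \<le> n" for i j
      using pV[OF that(1)] qW[OF that(2)] assms(7) by auto
    consider "x \<le> m" "y \<le> m" | "x \<le> m" "m < y" | "m < x" "y \<le> m" | "m < x" "m < y" by linarith
    then show "x = y"
    proof cases
      case 1
      then show ?thesis using xy is_path_eq_iff[OF p(1), of "m - x" "m - y"] by (auto simp: r_def)
    next
      case 2
      moreover have "y - Suc m \<le> n" using xy(2) by auto
      ultimately show ?thesis using xy(3) ne[of "m - x" "y - Suc m"] by (auto simp: r_def)
    next
      case 3
      moreover have "x - Suc m \<le> n" using xy(1) by auto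
      ultimately show ?thesis using xy(3) ne[of "m - y" "x - Suc m"] by (auto simp: r_def)
    next
      case 4
      then show ?thesis using xy is_path_eq_iff[OF q(1), of "x - Suc m" "y - Suc m"] by (auto simp: r_def)
    qed
  qed
  moreover have "{r i, r (Suc i)} \<in> C'" if i: "i < m + n + 1" for i
  proof -
    consider "i < m" | "i = m" | "m < i" by linarith
    then show ?thesis
    proof cases
      case 1
      then have "r i = p (Suc (m - Suc i))" "r (Suc i) = p (m - Suc i)"
        by (auto simp: r_def Suc_diff_Suc)
      moreover have "{p (m - Suc i), p (Suc (m - Suc i))} \<in> C"
        using p(1) 1 by (simp add: is_path_def)
      ultimately show ?thesis using assms(8) by (auto simp: insert_commute)
    next
      case 2
      then show ?thesis using p q assms(10) by (simp add: r_def)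
    next
      case 3
      then have "r i = q (i - Suc m)" "r (Suc i) = q (Suc (i - Suc m))"
        by (auto simp: r_def Suc_diff_Suc)
      moreover have "{q (i - Suc m), q (Suc (i - Suc m))} \<in> D"
        using q(1) 3 i by (simp add: is_path_def)
      ultimately show ?thesis using assms(9) by auto
    qed
  qed
  ultimately have "is_path C' r (m + n + 1)" by (simp add: is_path_def)
  moreover have "r 0 \<in> V" using pV by (simp add: r_def)
  ultimately show ?thesis by (auto simp: path_from_def)
qed

text \<open>\<open>U\<close> contains the vertices used so far.\<close>

definition board :: "nat \<Rightarrow> nat \<Rightarrow> position \<Rightarrow> nat set \<Rightarrow> bool" where
  "board a k s U \<longleftrightarrow> valid a k s \<and> U \<subseteq> {..<a} \<and> \<Union>(dom s) \<subseteq> U"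

text \<open>This expresses that play from \<open>s\<close> to \<open>s'\<close> took place off
  \<open>U\<close> and used at most \<open>N\<close> new vertices. The count makes it possible to
  say in advance how large a board is needed.\<close>

definition fresh_ext :: "nat \<Rightarrow> position \<Rightarrow> nat set \<Rightarrow> position \<Rightarrow> nat set \<Rightarrow> bool" where
  "fresh_ext N s U s' U' \<longleftrightarrow> U \<subseteq> U' \<and> card U' \<le> card U + N \<and> (\<forall>e. e \<inter> U \<noteq> {} \<longrightarrow> s' e = s e)"

definition color_class :: "position \<Rightarrow> nat set \<Rightarrow> nat \<Rightarrow> nat set set" where
  "color_class s V c = {e. e \<subseteq> V \<and> s e = Some c}"

text \<open>The property \<open>Q\<close> is given only the colored edges inside \<open>V\<close>,
  so later moves elsewhere cannot destroy it.\<close>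

definition contains ::
    "position \<Rightarrow> nat set \<Rightarrow> nat \<Rightarrow> ((nat \<Rightarrow> nat set set) \<Rightarrow> nat set \<Rightarrow> bool) \<Rightarrow> bool" where
  "contains s V K Q \<longleftrightarrow> separated (dom s) V \<and> card {e \<in> dom s. e \<subseteq> V} \<le> K \<and> Q (color_class s V) V"

text \<open>A continuation-style form of "Builder can steer from \<open>s\<close> to a position
  satisfying \<open>P\<close>": whenever all such positions are won, \<open>s\<close> is won.
  Strategies can thus be composed one after the other without being described as objects.\<close>

definition reach ::
    "nat sgraph \<Rightarrow> nat \<Rightarrow> nat \<Rightarrow> position \<Rightarrow> (position \<Rightarrow> nat set \<Rightarrow> bool) \<Rightarrow> bool" where
  "reach F a k s P \<longleftrightarrow>
    ((\<forall>s' U'. board a k s' U' \<longrightarrow> P s' U' \<longrightarrow> builder_forces F 2 a k s') \<longrightarrow> builder_forces F 2 a k s)"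

definition forcible_with :: "nat sgraph \<Rightarrow> nat \<Rightarrow> nat \<Rightarrow>
    ((nat \<Rightarrow> nat set set) \<Rightarrow> nat set \<Rightarrow> bool) \<Rightarrow> nat \<Rightarrow> bool" where
  "forcible_with F k K Q N \<longleftrightarrow> (\<forall>a s U. board a k s U \<longrightarrow> card U + N \<le> a \<longrightarrow>
    reach F a k s (\<lambda>s' U'. fresh_ext N s U s' U' \<and> (\<exists>V. V \<subseteq> U' - U \<and> contains s' V K Q)))"

definition forcible ::
    "nat sgraph \<Rightarrow> nat \<Rightarrow> nat \<Rightarrow> ((nat \<Rightarrow> nat set set) \<Rightarrow> nat set \<Rightarrow> bool) \<Rightarrow> bool" where
  "forcible F k K Q \<longleftrightarrow> (\<exists>N. forcible_with F k K Q N)"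

lemma reach_done: "board a k s U \<Longrightarrow> P s U \<Longrightarrow> reach F a k s P"
  by (auto simp: reach_def)

lemma reach_bind:
  "reach F a k s P \<Longrightarrow> (\<And>s' U'. board a k s' U' \<Longrightarrow> P s' U' \<Longrightarrow> reach F a k s' P') \<Longrightarrow> reach F a k s P'"
  unfolding reach_def by blast

lemma reach_move:
  "legal_move a k s e \<Longrightarrow> (\<And>c. c < 2 \<Longrightarrow> reach F a k (s(e \<mapsto> c)) P) \<Longrightarrow> reach F a k s P"
  unfolding reach_def by (meson builder_forces.move)

lemma fresh_ext_trans:
  "fresh_ext M s U s' U' \<Longrightarrow> fresh_ext N s' U' s'' U'' \<Longrightarrow> fresh_ext (M + N) s U s'' U''"
proof -
  assume 1: "fresh_ext M s U s' U'" and 2: "fresh_ext N s' U' s'' U''"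
  have "s'' e = s e" if "e \<inter> U \<noteq> {}" for e
  proof -
    have "e \<inter> U' \<noteq> {}" using that 1 unfolding fresh_ext_def by blast
    then show ?thesis using that 1 2 by (simp add: fresh_ext_def)
  qed
  then show ?thesis using 1 2 by (auto simp: fresh_ext_def)
qed

lemma fresh_ext_le: "fresh_ext M s U s' U' \<Longrightarrow> M \<le> N \<Longrightarrow> fresh_ext N s U s' U'"
  by (auto simp: fresh_ext_def)

lemma contains_mono:
  "contains s V K Q \<Longrightarrow> K \<le> K' \<Longrightarrow> (\<And>C V. Q C V \<Longrightarrow> Q' C V) \<Longrightarrow> contains s V K' Q'"
  by (auto simp: contains_def)

lemma forcible_mono:
  assumes "forcible F k K Q" "K \<le> K'" "\<And>C V. Q C V \<Longrightarrow> Q' C V"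
  shows "forcible F k K' Q'"
proof -
  obtain N where N: "\<And>a s U. board a k s U \<Longrightarrow> card U + N \<le> a \<Longrightarrow>
    reach F a k s (\<lambda>s' U'. fresh_ext N s U s' U' \<and> (\<exists>V. V \<subseteq> U' - U \<and> contains s' V K Q))"
    using assms(1) unfolding forcible_def forcible_with_def by blast
  have "reach F a k s (\<lambda>s' U'. fresh_ext N s U s' U' \<and> (\<exists>V. V \<subseteq> U' - U \<and> contains s' V K' Q'))"
    if "board a k s U" "card U + N \<le> a" for a s U
  proof (rule reach_bind[OF N[OF that]])
    fix s' U' assume s': "board a k s' U'"
      and "fresh_ext N s U s' U' \<and> (\<exists>V. V \<subseteq> U' - U \<and> contains s' V K Q)"
    then obtain V where V: "fresh_ext N s U s' U'" "V \<subseteq> U' - U" "contains s' V K Q" by blast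
    have "contains s' V K' Q'" using V(3) assms(2,3) by (rule contains_mono)
    then show "reach F a k s' (\<lambda>s' U'. fresh_ext N s U s' U' \<and> (\<exists>V. V \<subseteq> U' - U \<and> contains s' V K' Q'))"
      using V s' by (intro reach_done[OF s']) blast
  qed
  then show ?thesis unfolding forcible_def forcible_with_def by blast
qed

lemma contains_persists:
  assumes "contains s V K Q" "V \<subseteq> U" "board a k s U" "board a k s' U'" "fresh_ext N s U s' U'"
  shows "contains s' V K Q"
proof -
  \<comment> \<open>The empty set is a subset of \<open>V\<close> that meets no set, so
    \<open>fresh_ext\<close> says nothing about it. It is never an edge.\<close>
  have 0: "{} \<notin> dom s" "{} \<notin> dom s'"
    using assms(3,4) unfolding board_def valid_def by (metis card.empty zero_neq_numeral)+
  have eq: "s' e = s e" if "e \<inter> V \<noteq> {}" for e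
    using that assms(2,5) by (auto simp: fresh_ext_def)
  have sub: "s' e = s e" if "e \<subseteq> V" for e
    using eq[of e] that 0 by (cases "e = {}") (auto simp: domIff)
  have "separated (dom s') V"
    unfolding separated_def
  proof
    fix e assume e: "e \<in> dom s'"
    show "e \<subseteq> V \<or> e \<inter> V = {}"
    proof (cases "e \<inter> V = {}")
      case False
      then have "e \<in> dom s" using eq e by (simp add: domIff)
      then show ?thesis using assms(1) by (simp add: contains_def separated_def)
    qed simp
  qed
  moreover have "{e \<in> dom s'. e \<subseteq> V} = {e \<in> dom s. e \<subseteq> V}" "color_class s' V = color_class s V"
    using sub by (auto simp: color_class_def domIff fun_eq_iff)
  ultimately show ?thesis using assms(1) by (simp add: contains_def)
qed

text \<open>The bookkeeping for an edge between two components built separately: it is legal as soon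
  as \<open>k\<close> admits the edges of both and one more, and the colored paths on either side
  are preserved.\<close>

lemma join_move:
  assumes s: "board a k s U" and VW: "V \<subseteq> U" "W \<subseteq> U" "V \<inter> W = {}"
    and V: "contains s V K\<^sub>1 P" and W: "contains s W K\<^sub>2 Q"
    and K: "K\<^sub>1 + K\<^sub>2 + 1 \<le> k" and vw: "v \<in> V" "w \<in> W"
  shows "legal_move a k s {v, w}"
    and "board a k (s({v, w} \<mapsto> c)) U"
    and "separated (dom (s({v, w} \<mapsto> c))) (V \<union> W)"
    and "card {e \<in> dom (s({v, w} \<mapsto> c)). e \<subseteq> V \<union> W} \<le> K\<^sub>1 + K\<^sub>2 + 1"
    and "color_class s V x \<subseteq> color_class (s({v, w} \<mapsto> c)) (V \<union> W) x"
    and "color_class s W x \<subseteq> color_class (s({v, w} \<mapsto> c)) (V \<union> W) x"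
    and "{v, w} \<in> color_class (s({v, w} \<mapsto> c)) (V \<union> W) c"
proof -
  let ?e = "{v, w}"
  have valid: "valid a k s" and U: "U \<subseteq> {..<a}" "\<Union>(dom s) \<subseteq> U" using s by (auto simp: board_def)
  have sep: "separated (dom s) V" "separated (dom s) W" using V W by (auto simp: contains_def)
  have fin: "finite (dom s)" using valid by (rule valid_finite)
  have ne: "v \<noteq> w" "v \<notin> W" "w \<notin> V" using vw VW by auto
  have new: "?e \<notin> dom s"
  proof
    assume "?e \<in> dom s"
    then have "?e \<subseteq> V \<or> ?e \<inter> V = {}" by (rule bspec[OF sep(1)[unfolded separated_def]])
    then show False using vw ne by blast
  qed
  have "{e \<in> insert ?e (dom s). e \<subseteq> V \<union> W} \<subseteq>
      insert ?e ({e \<in> dom s. e \<subseteq> V} \<union> {e \<in> dom s. e \<subseteq> W})"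
  proof
    fix e assume "e \<in> {e \<in> insert ?e (dom s). e \<subseteq> V \<union> W}"
    then show "e \<in> insert ?e ({e \<in> dom s. e \<subseteq> V} \<union> {e \<in> dom s. e \<subseteq> W})"
      using sep unfolding separated_def by blast
  qed
  then have "card {e \<in> insert ?e (dom s). e \<subseteq> V \<union> W} \<le>
      card (insert ?e ({e \<in> dom s. e \<subseteq> V} \<union> {e \<in> dom s. e \<subseteq> W}))"
    using fin by (intro card_mono) auto
  also have "\<dots> \<le> Suc (card {e \<in> dom s. e \<subseteq> V} + card {e \<in> dom s. e \<subseteq> W})"
    using card_Un_le[of "{e \<in> dom s. e \<subseteq> V}" "{e \<in> dom s. e \<subseteq> W}"] fin
    by (auto simp: card_insert_if)
  also have "\<dots> \<le> K\<^sub>1 + K\<^sub>2 + 1" using V W by (simp add: contains_def)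
  finally have cardVW: "card {e \<in> insert ?e (dom s). e \<subseteq> V \<union> W} \<le> K\<^sub>1 + K\<^sub>2 + 1" .
  have "(v, w) \<notin> conn (dom s)" using separated_conn[OF _ sep(1)] vw ne by blast
  then have forest: "is_forest (insert ?e (dom s))"
    using valid by (intro forest_insert) (auto simp: valid_def)
  have comp: "card (component_edges (insert ?e (dom s)) x) \<le> k" if "x < a" for x
  proof (cases "x \<in> V \<union> W")
    case True
    have "card (component_edges (insert ?e (dom s)) x) \<le> card {e \<in> insert ?e (dom s). e \<subseteq> V \<union> W}"
      by (rule card_mono[OF _ component_edges_insert(1)[OF sep vw True]]) (use fin in auto)
    then show ?thesis using cardVW K by linarith
  next
    case False
    have "card (component_edges (insert ?e (dom s)) x) \<le> card (component_edges (dom s) x)"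
      by (rule card_mono[OF _ component_edges_insert(2)[OF sep vw False]])
        (use fin in \<open>auto simp: component_edges_def\<close>)
    then show ?thesis using valid that by (auto simp: valid_def intro: order_trans)
  qed
  show legal: "legal_move a k s ?e"
    using new forest comp ne vw VW U by (auto simp: legal_move_def)
  show "board a k (s(?e \<mapsto> c)) U"
    using valid_move[OF valid legal] U VW vw by (auto simp: board_def)
  show "separated (dom (s(?e \<mapsto> c))) (V \<union> W)"
    using sep vw by (auto simp: separated_def)
  show "card {e \<in> dom (s(?e \<mapsto> c)). e \<subseteq> V \<union> W} \<le> K\<^sub>1 + K\<^sub>2 + 1"
    using cardVW by simp
  show "color_class s V x \<subseteq> color_class (s(?e \<mapsto> c)) (V \<union> W) x"
    "color_class s W x \<subseteq> color_class (s(?e \<mapsto> c)) (V \<union> W) x"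
    using new by (auto simp: color_class_def domIff)
  show "?e \<in> color_class (s(?e \<mapsto> c)) (V \<union> W) c"
    using vw by (simp add: color_class_def)
qed

section \<open>Builder's strategy\<close>

lemma forcible_withD:
  assumes "forcible_with F k K Q N" "board a k s U" "card U + N \<le> a"
    and "\<And>s' U' V. board a k s' U' \<Longrightarrow> fresh_ext N s U s' U' \<Longrightarrow> V \<subseteq> U' - U \<Longrightarrow> contains s' V K Q \<Longrightarrow>
      reach F a k s' P"
  shows "reach F a k s P"
  by (rule reach_bind[OF assms(1)[unfolded forcible_with_def, rule_format, OF assms(2,3)]])
    (use assms(4) in blast)

lemma fresh_ext_upd:
  "fresh_ext N s U s' U' \<Longrightarrow> e \<inter> U = {} \<Longrightarrow> fresh_ext N s U (s'(e \<mapsto> c)) U'"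
  by (auto simp: fresh_ext_def)

definition some_path :: "(nat \<Rightarrow> nat) \<Rightarrow> (nat \<Rightarrow> nat set set) \<Rightarrow> nat set \<Rightarrow> bool" where
  "some_path L C V \<longleftrightarrow> (\<exists>c<2. \<exists>v\<in>V. path_from (C c) v (L c))"

definition common_end :: "(nat \<Rightarrow> nat) \<Rightarrow> (nat \<Rightarrow> nat set set) \<Rightarrow> nat set \<Rightarrow> bool" where
  "common_end L C V \<longleftrightarrow> (\<exists>v\<in>V. \<forall>c<2. path_from (C c) v (L c))"

lemma forcible_vertex:
  assumes "c < 2" "L c = 0"
  shows "forcible F k 0 (some_path L)"
proof -
  have "reach F a k s (\<lambda>s' U'. fresh_ext 1 s U s' U' \<and> (\<exists>V. V \<subseteq> U' - U \<and> contains s' V 0 (some_path L)))"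
    if b: "board a k s U" and a: "card U + 1 \<le> a" for a s U
  proof -
    have U: "U \<subseteq> {..<a}" "\<Union>(dom s) \<subseteq> U" and card: "\<And>e. e \<in> dom s \<Longrightarrow> card e = 2"
      using b by (auto simp: board_def valid_def)
    then have "U \<noteq> {..<a}" using a by auto
    then obtain z where z: "z < a" "z \<notin> U" using U by blast
    have fin: "finite U" using U(1) finite_subset by blast
    have no: "z \<notin> e" "\<not> e \<subseteq> {z}" if "e \<in> dom s" for e
    proof -
      show "z \<notin> e" using U(2) z(2) that by blast
      then show "\<not> e \<subseteq> {z}" using card[OF that] by (auto simp: subset_singleton_iff)
    qed
    have 1: "board a k s (insert z U)" using b z by (auto simp: board_def)
    have 2: "fresh_ext 1 s U s (insert z U)" using fin z by (auto simp: fresh_ext_def)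
    have "separated (dom s) {z}" "{e \<in> dom s. e \<subseteq> {z}} = {}" using no by (auto simp: separated_def)
    moreover have "some_path L (color_class s {z}) {z}"
      using assms by (auto simp: some_path_def)
    ultimately have "contains s {z} 0 (some_path L)" by (simp add: contains_def)
    then show ?thesis
      using 2 z(2) by (intro reach_done[OF 1]) blast
  qed
  then show ?thesis unfolding forcible_def forcible_with_def by blast
qed

lemma color_class_subset: "e \<in> color_class s V c \<Longrightarrow> e \<subseteq> V"
  by (simp add: color_class_def)

text \<open>Whichever color the edge between the ends of a path of color \<open>c\<close> and of a path of the other
  color receives, one of its two ends is now the end of both paths.\<close>

lemma forcible_common_end:
  assumes "forcible F k K\<^sub>2 (some_path L)"
    and "\<And>c. c < 2 \<Longrightarrow> forcible F k K\<^sub>1 (some_path (L(c := 2 * L c + 1)))"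
    and K: "K\<^sub>2 + K\<^sub>1 + 1 \<le> k"
  shows "forcible F k (K\<^sub>2 + K\<^sub>1 + 1) (\<lambda>C V. common_end L C V \<or> some_path (\<lambda>c. 2 * L c + 1) C V)"
proof -
  let ?Q = "\<lambda>C V. common_end L C V \<or> some_path (\<lambda>c. 2 * L c + 1) C V"
  let ?K = "K\<^sub>2 + K\<^sub>1 + 1"
  obtain N where N: "forcible_with F k K\<^sub>2 (some_path L) N"
    using assms(1) by (auto simp: forcible_def)
  obtain N' where N': "\<And>c. c < 2 \<Longrightarrow> forcible_with F k K\<^sub>1 (some_path (L(c := 2 * L c + 1))) (N' c)"
    using assms(2) unfolding forcible_def by metis
  \<comment> \<open>The color \<open>c\<close> of the first path is Painter's choice, so room is
    reserved for both continuations.\<close>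
  define M where "M = N + N' 0 + N' 1"
  have M: "N + N' c \<le> M" if "c < 2" for c
    using that by (auto simp: M_def less_2_cases_iff)
  have "reach F a k s (\<lambda>s' U'. fresh_ext M s U s' U' \<and> (\<exists>V. V \<subseteq> U' - U \<and> contains s' V ?K ?Q))"
    (is "reach F a k s ?P") if b: "board a k s U" and a: "card U + M \<le> a" for a s U
  proof (rule forcible_withD[OF N b])
    show "card U + N \<le> a" using a M[of 0] by simp
    fix s\<^sub>1 U\<^sub>1 V
    assume b1: "board a k s\<^sub>1 U\<^sub>1" and e1: "fresh_ext N s U s\<^sub>1 U\<^sub>1" and V: "V \<subseteq> U\<^sub>1 - U"
      and V': "contains s\<^sub>1 V K\<^sub>2 (some_path L)"
    obtain c v where c: "c < 2" and v: "v \<in> V" "path_from (color_class s\<^sub>1 V c) v (L c)"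
      using V' by (auto simp: contains_def some_path_def)
    have V1: "contains s\<^sub>1 V K\<^sub>2 (\<lambda>C V. path_from (C c) v (L c))"
      using V' v by (simp add: contains_def)
    show "reach F a k s\<^sub>1 ?P"
    \<comment> \<open>The second game raises the target only in the color \<open>c\<close> already
      obtained. It ends either with the doubled path in this color, which is enough, or with a path
      of the original length in the other color.\<close>
    proof (rule forcible_withD[OF N'[OF c] b1])
      show "card U\<^sub>1 + N' c \<le> a" using e1 M[OF c] a by (simp add: fresh_ext_def)
      fix s\<^sub>2 U\<^sub>2 W
      assume b2: "board a k s\<^sub>2 U\<^sub>2" and e2: "fresh_ext (N' c) s\<^sub>1 U\<^sub>1 s\<^sub>2 U\<^sub>2" and W: "W \<subseteq> U\<^sub>2 - U\<^sub>1"
        and W': "contains s\<^sub>2 W K\<^sub>1 (some_path (L(c := 2 * L c + 1)))"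
      have e: "fresh_ext M s U s\<^sub>2 U\<^sub>2"
        using fresh_ext_le[OF fresh_ext_trans[OF e1 e2] M[OF c]] .
      have UU: "U \<subseteq> U\<^sub>1" "U\<^sub>1 \<subseteq> U\<^sub>2" using e1 e2 by (auto simp: fresh_ext_def)
      obtain d w where d: "d < 2" and w: "w \<in> W"
        "path_from (color_class s\<^sub>2 W d) w ((L(c := 2 * L c + 1)) d)"
        using W' by (auto simp: contains_def some_path_def)
      show "reach F a k s\<^sub>2 ?P"
      proof (cases "d = c")
        case True
        then have "path_from (color_class s\<^sub>2 W c) w (2 * L c + 1)" using w(2) by simp
        then have "some_path (\<lambda>c. 2 * L c + 1) (color_class s\<^sub>2 W) W"
          using c w(1) unfolding some_path_def by blast
        then have "contains s\<^sub>2 W ?K ?Q" using W' by (simp add: contains_def)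
        moreover have "W \<subseteq> U\<^sub>2 - U" using W UU by blast
        ultimately show ?thesis using e by (intro reach_done[OF b2]) blast
      next
        case False
        then have w': "path_from (color_class s\<^sub>2 W d) w (L d)" using w(2) by simp
        have V2: "contains s\<^sub>2 V K\<^sub>2 (\<lambda>C V. path_from (C c) v (L c))"
          using V by (intro contains_persists[OF V1 _ b1 b2 e2]) blast
        then have v': "path_from (color_class s\<^sub>2 V c) v (L c)" by (simp add: contains_def)
        have sub: "V \<subseteq> U\<^sub>2" "W \<subseteq> U\<^sub>2" "V \<inter> W = {}" using V W UU by auto
        have notin: "v \<notin> W" "w \<notin> V" using sub v w by auto
        note join = join_move[OF b2 sub V2 W' K v(1) w(1)]
        have "?P (s\<^sub>2({v, w} \<mapsto> x)) U\<^sub>2" if "x < 2" for x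
        proof -
          let ?s = "s\<^sub>2({v, w} \<mapsto> x)" and ?C = "color_class (s\<^sub>2({v, w} \<mapsto> x)) (V \<union> W)"
          have cases: "x = c \<or> x = d" "\<And>y. y < 2 \<Longrightarrow> y = c \<or> y = d"
            using that c d False by (auto simp: less_2_cases_iff)
          have cv: "path_from (?C c) v (L c)" and dw: "path_from (?C d) w (L d)"
            using path_from_mono[OF v' join(5)] path_from_mono[OF w' join(6)] by blast+
          have "common_end L ?C (V \<union> W)"
          proof (cases "x = c")
            case True
            have "path_from (?C c) w (Suc (L c))"
              by (rule path_from_Cons[OF v' color_class_subset v(1) notin(2) join(5)])
                (use join(7) True in auto)
            then have "path_from (?C c) w (L c)" by (rule path_from_le) simp
            then have "\<forall>y<2. path_from (?C y) w (L y)" using dw cases(2) by metis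
            then show ?thesis using w(1) unfolding common_end_def by blast
          next
            case False
            then have x: "x = d" using cases(1) by simp
            have "path_from (?C d) v (Suc (L d))"
              by (rule path_from_Cons[OF w' color_class_subset w(1) notin(1) join(6)])
                (use join(7) x in \<open>auto simp: insert_commute\<close>)
            then have "path_from (?C d) v (L d)" by (rule path_from_le) simp
            then have "\<forall>y<2. path_from (?C y) v (L y)" using cv cases(2) by metis
            then show ?thesis using v(1) unfolding common_end_def by blast
          qed
          then have "contains ?s (V \<union> W) ?K ?Q"
            using join(3,4)[of x] unfolding contains_def by blast
          moreover have "V \<union> W \<subseteq> U\<^sub>2 - U" using V W UU by blast
          moreover have "fresh_ext M s U ?s U\<^sub>2"
            using V W UU v(1) w(1) by (intro fresh_ext_upd[OF e]) blast
          ultimately show ?thesis by blast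
        qed
        then show ?thesis
          by (intro reach_move[OF join(1)] reach_done[OF join(2)])
      qed
    qed
  qed
  then show ?thesis unfolding forcible_def forcible_with_def by blast
qed

text \<open>Build the structure twice. If neither copy already has a path of doubled length, both
  have a common end. An edge between these ends, of whatever color \<open>x\<close>, joins two paths
  of length \<open>L x\<close> in its own color.\<close>

lemma forcible_double:
  assumes "forcible F k K (\<lambda>C V. common_end L C V \<or> some_path (\<lambda>c. 2 * L c + 1) C V)"
    and K: "K + K + 1 \<le> k"
  shows "forcible F k (K + K + 1) (some_path (\<lambda>c. 2 * L c + 1))"
proof -
  let ?Q = "some_path (\<lambda>c. 2 * L c + 1)"
  obtain N where N: "forcible_with F k K (\<lambda>C V. common_end L C V \<or> ?Q C V) N"
    using assms(1) by (auto simp: forcible_def)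
  have "reach F a k s (\<lambda>s' U'. fresh_ext (N + N) s U s' U' \<and>
      (\<exists>V. V \<subseteq> U' - U \<and> contains s' V (K + K + 1) ?Q))"
    (is "reach F a k s ?P") if b: "board a k s U" and a: "card U + (N + N) \<le> a" for a s U
  proof (rule forcible_withD[OF N b])
    show "card U + N \<le> a" using a by simp
    fix s\<^sub>1 U\<^sub>1 V
    assume b1: "board a k s\<^sub>1 U\<^sub>1" and e1: "fresh_ext N s U s\<^sub>1 U\<^sub>1" and V: "V \<subseteq> U\<^sub>1 - U"
      and V': "contains s\<^sub>1 V K (\<lambda>C V. common_end L C V \<or> ?Q C V)"
    have e1': "fresh_ext (N + N) s U s\<^sub>1 U\<^sub>1" using e1 by (rule fresh_ext_le) simp
    show "reach F a k s\<^sub>1 ?P"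
    proof (cases "?Q (color_class s\<^sub>1 V) V")
      case True
      then have "contains s\<^sub>1 V (K + K + 1) ?Q" using V' by (simp add: contains_def)
      then show ?thesis using e1' V by (intro reach_done[OF b1]) blast
    next
      case False
      then obtain v where v: "v \<in> V" "\<forall>c<2. path_from (color_class s\<^sub>1 V c) v (L c)"
        using V' by (auto simp: contains_def common_end_def)
      then have V1: "contains s\<^sub>1 V K (\<lambda>C V. \<forall>c<2. path_from (C c) v (L c))"
        using V' by (simp add: contains_def)
      show ?thesis
      proof (rule forcible_withD[OF N b1])
        show "card U\<^sub>1 + N \<le> a" using e1 a by (simp add: fresh_ext_def)
        fix s\<^sub>2 U\<^sub>2 W
        assume b2: "board a k s\<^sub>2 U\<^sub>2" and e2: "fresh_ext N s\<^sub>1 U\<^sub>1 s\<^sub>2 U\<^sub>2" and W: "W \<subseteq> U\<^sub>2 - U\<^sub>1"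
          and W': "contains s\<^sub>2 W K (\<lambda>C V. common_end L C V \<or> ?Q C V)"
        have e: "fresh_ext (N + N) s U s\<^sub>2 U\<^sub>2" using e1 e2 by (rule fresh_ext_trans)
        have UU: "U \<subseteq> U\<^sub>1" "U\<^sub>1 \<subseteq> U\<^sub>2" using e1 e2 by (auto simp: fresh_ext_def)
        show "reach F a k s\<^sub>2 ?P"
        proof (cases "?Q (color_class s\<^sub>2 W) W")
          case True
          then have "contains s\<^sub>2 W (K + K + 1) ?Q" using W' by (simp add: contains_def)
          moreover have "W \<subseteq> U\<^sub>2 - U" using W UU by blast
          ultimately show ?thesis using e by (intro reach_done[OF b2]) blast
        next
          case False
          then obtain w where w: "w \<in> W" "\<forall>c<2. path_from (color_class s\<^sub>2 W c) w (L c)"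
            using W' by (auto simp: contains_def common_end_def)
          have V2: "contains s\<^sub>2 V K (\<lambda>C V. \<forall>c<2. path_from (C c) v (L c))"
            using V by (intro contains_persists[OF V1 _ b1 b2 e2]) blast
          then have v': "\<forall>c<2. path_from (color_class s\<^sub>2 V c) v (L c)" by (simp add: contains_def)
          have sub: "V \<subseteq> U\<^sub>2" "W \<subseteq> U\<^sub>2" "V \<inter> W = {}" using V W UU by auto
          note join = join_move[OF b2 sub V2 W' K v(1) w(1)]
          have "?P (s\<^sub>2({v, w} \<mapsto> x)) U\<^sub>2" if x: "x < 2" for x
          proof -
            let ?s = "s\<^sub>2({v, w} \<mapsto> x)"
            have "\<exists>y\<in>V. path_from (color_class ?s (V \<union> W) x) y (L x + L x + 1)"
              by (rule path_from_join[OF v'[rule_format, OF x] color_class_subset v(1)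
                    w(2)[rule_format, OF x] color_class_subset w(1) sub(3) join(5) join(6) join(7)])
            then have "?Q (color_class ?s (V \<union> W)) (V \<union> W)"
              using x unfolding some_path_def mult_2 by blast
            then have "contains ?s (V \<union> W) (K + K + 1) ?Q"
              using join(3,4)[of x] unfolding contains_def by blast
            moreover have "V \<union> W \<subseteq> U\<^sub>2 - U" using V W UU by blast
            moreover have "fresh_ext (N + N) s U ?s U\<^sub>2"
              using V W UU v(1) w(1) by (intro fresh_ext_upd[OF e]) blast
            ultimately show ?thesis by blast
          qed
          then show ?thesis
            by (intro reach_move[OF join(1)] reach_done[OF join(2)])
        qed
      qed
    qed
  qed
  then show ?thesis unfolding forcible_def forcible_with_def by blast
qed

section \<open>The recursion for the size of the trees\<close>

fun size_bound :: "nat \<Rightarrow> nat" where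
  "size_bound 0 = 0"
| "size_bound (Suc 0) = 0"
| "size_bound (Suc (Suc n)) = 2 * size_bound (Suc n) + 2 * size_bound n + 3"

text \<open>The lengths \<open>2 ^ p - 1\<close> are those obtained from 0 by iterating the doubling
  step that takes \<open>L\<close> to \<open>2 * L + 1\<close>.\<close>

definition path_lengths :: "nat \<Rightarrow> nat \<Rightarrow> nat \<Rightarrow> nat" where
  "path_lengths p q c = (if c = 0 then 2 ^ p - 1 else if c = 1 then 2 ^ q - 1 else 0)"

text \<open>One parameter suffices for the bound because the two games that may be played second,
  for \<open>(Suc p', q')\<close> and \<open>(p', Suc q')\<close>, have the same sum. If
  \<open>p\<close> or \<open>q\<close> is 0, a path without edges is asked for.\<close>

lemma forcible_some_path:
  "size_bound (p + q) \<le> k \<Longrightarrow> forcible F k (size_bound (p + q)) (some_path (path_lengths p q))"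
proof (induction "p + q" arbitrary: p q rule: less_induct)
  case less
  consider "p = 0" | "q = 0" | p' q' where "p = Suc p'" "q = Suc q'"
    by (metis not0_implies_Suc)
  then show ?case
  proof cases
    case 1
    then have "forcible F k 0 (some_path (path_lengths p q))"
      by (intro forcible_vertex[of 0]) (auto simp: path_lengths_def)
    then show ?thesis by (rule forcible_mono) auto
  next
    case 2
    then have "forcible F k 0 (some_path (path_lengths p q))"
      by (intro forcible_vertex[of 1]) (auto simp: path_lengths_def)
    then show ?thesis by (rule forcible_mono) auto
  next
    case 3
    let ?m = "p' + q'"
    \<comment> \<open>One structure with a common end: a game of sum \<open>?m\<close>, a game of
      sum \<open>Suc ?m\<close> and the edge between them. Two such structures and one more edge
      give the recursion of \<open>size_bound\<close>.\<close>
    let ?K = "size_bound ?m + size_bound (Suc ?m) + 1"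
    have K: "size_bound (p + q) = ?K + ?K + 1" using 3 by simp
    have double: "2 * (2 ^ n - 1) + 1 = (2 ^ Suc n - 1 :: nat)" for n
    proof -
      have "(1 :: nat) \<le> 2 ^ n" by simp
      then show ?thesis unfolding power_Suc by linarith
    qed
    have f0: "forcible F k (size_bound ?m) (some_path (path_lengths p' q'))"
      using less.hyps[of p' q'] less.prems K 3 by simp
    have f1: "forcible F k (size_bound (Suc ?m)) (some_path ((path_lengths p' q')(c := 2 * path_lengths p' q' c + 1)))"
      if "c < 2" for c
    proof (cases "c = 0")
      case True
      have "(path_lengths p' q')(c := 2 * path_lengths p' q' c + 1) = path_lengths (Suc p') q'"
        using True double[of p'] by (auto simp: path_lengths_def fun_eq_iff)
      then show ?thesis using less.hyps[of "Suc p'" q'] less.prems K 3 by simp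
    next
      case False
      then have "c = 1" using that by simp
      then have "(path_lengths p' q')(c := 2 * path_lengths p' q' c + 1) = path_lengths p' (Suc q')"
        using double[of q'] by (auto simp: path_lengths_def fun_eq_iff)
      then show ?thesis using less.hyps[of p' "Suc q'"] less.prems K 3 by simp
    qed
    have "forcible F k (?K + ?K + 1) (some_path (\<lambda>c. 2 * path_lengths p' q' c + 1))"
      by (rule forcible_double[OF forcible_common_end[OF f0 f1]]) (use less.prems K in auto)
    then show ?thesis
      unfolding K
    proof (rule forcible_mono)
      fix C V assume "some_path (\<lambda>c. 2 * path_lengths p' q' c + 1) C V"
      moreover have "2 * path_lengths p' q' c + 1 = path_lengths p q c" if "c < 2" for c
        using that double[of p'] double[of q'] 3 by (auto simp: path_lengths_def less_2_cases_iff)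
      ultimately show "some_path (path_lengths p q) C V" unfolding some_path_def by metis
    qed simp
  qed
qed

text \<open>The game for \<open>(p, p)\<close> is played on an empty board with exactly the number
  \<open>N\<close> of vertices that its strategy asks for. Either color then has a path with at
  least \<open>l\<close> edges as its target.\<close>

lemma builder_wins_size_bound:
  assumes "l < 2 ^ p"
  shows "builder_wins (path_graph l) 2 (size_bound (p + p))"
proof -
  let ?F = "path_graph l" and ?k = "size_bound (p + p)"
  obtain N where N: "forcible_with ?F ?k ?k (some_path (path_lengths p p)) N"
    using forcible_some_path[OF order_refl] unfolding forcible_def by blast
  have b: "board N ?k Map.empty {}" by (simp add: board_def valid_empty)
  have "reach ?F N ?k Map.empty (\<lambda>s U. has_mono_copy ?F 2 N s)"
  proof (rule forcible_withD[OF N b])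
    fix s U V assume s: "board N ?k s U" and V: "V \<subseteq> U - {}"
      and V': "contains s V ?k (some_path (path_lengths p p))"
    obtain c v where c: "c < 2" "v \<in> V" "path_from (color_class s V c) v (path_lengths p p c)"
      using V' by (auto simp: contains_def some_path_def)
    have "l \<le> path_lengths p p c" using assms c(1) by (auto simp: path_lengths_def less_2_cases_iff)
    then obtain f where f: "is_path (color_class s V c) f l" "f 0 = v"
      using path_from_le[OF c(3)] by (auto simp: path_from_def)
    have "f i \<in> V" if "i \<le> l" for i
      by (rule is_path_in[OF f(1) color_class_subset _ that]) (use f(2) c(2) in auto)
    then have "f ` {0..l} \<subseteq> V" by auto
    moreover have "V \<subseteq> {..<N}" using V s by (auto simp: board_def)
    ultimately have "f ` {0..l} \<subseteq> {..<N}" by (rule order_trans)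
    moreover have "inj_on f {0..l}" "\<forall>e\<in>{{i, Suc i} | i. i < l}. s (f ` e) = Some c"
      using f(1) by (auto simp: is_path_def color_class_def atLeast0AtMost)
    ultimately have "has_mono_copy ?F 2 N s"
      using c(1) unfolding has_mono_copy_def path_graph_def by auto
    then show "reach ?F N ?k s (\<lambda>s U. has_mono_copy ?F 2 N s)" by (rule reach_done[OF s])
  qed simp
  then have "builder_forces ?F 2 N ?k Map.empty"
    unfolding reach_def using builder_forces.copy by blast
  then show ?thesis unfolding builder_wins_def by blast
qed

text \<open>The subtracted 1 absorbs the summand 3 of the recursion, since
  \<open>- 2 - 2 + 3 = - 1\<close>. What remains is the equation for
  \<open>1 + sqrt 3\<close>.\<close>

lemma size_bound_le: "real (size_bound n) \<le> (1 + sqrt 3) ^ n - 1"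
proof (induction n rule: size_bound.induct)
  case (3 n)
  have "(1 + sqrt 3) * (1 + sqrt 3) = 2 * (1 + sqrt 3) + 2" by (simp add: algebra_simps)
  then have "(1 + sqrt 3) ^ Suc (Suc n) = (2 * (1 + sqrt 3) + 2) * (1 + sqrt 3) ^ n"
    by (metis mult.assoc power_Suc)
  also have "\<dots> = 2 * (1 + sqrt 3) ^ Suc n + 2 * (1 + sqrt 3) ^ n" by (simp add: algebra_simps)
  finally show ?case using 3 by simp
qed auto

section \<open>Growth of the least tree size\<close>

lemma kstar_builder_wins: "builder_wins F r k \<Longrightarrow> builder_wins F r (kstar F r) \<and> kstar F r \<le> k"
  unfolding kstar_def by (simp add: LeastI Least_le)

text \<open>For the least \<open>p\<close> with \<open>l < 2 ^ p\<close> one has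
  \<open>2 ^ p \<le> 2 * l\<close>. The bound \<open>(1 + sqrt 3) ^ (2 * p)\<close> is the power of
  \<open>2 ^ p\<close> with exponent \<open>2 * log 2 (1 + sqrt 3)\<close>, and the factor 2 in
  \<open>2 * l\<close> becomes the constant.\<close>

lemma kstar_le:
  assumes "1 \<le> l"
  shows "real (kstar (path_graph l) 2) \<le>
    2 powr (2 * log 2 (1 + sqrt 3)) * real l powr (2 * log 2 (1 + sqrt 3))"
proof -
  define x where "x = 1 + sqrt 3"
  have x: "1 < x" by (simp add: x_def)
  define p where "p = (LEAST p. l < 2 ^ p)"
  have p: "l < 2 ^ p" unfolding p_def by (rule LeastI[of _ l]) simp
  have "p \<noteq> 0" using p assms by (cases p) auto
  then have "\<not> l < 2 ^ (p - 1)" using not_less_Least[of "p - 1" "\<lambda>p. l < 2 ^ p"] by (simp add: p_def)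
  then have "2 ^ p \<le> 2 * l" using \<open>p \<noteq> 0\<close> by (cases p) auto
  then have 2: "(2 :: real) ^ p \<le> 2 * real l" by (metis of_nat_le_iff of_nat_mult of_nat_numeral of_nat_power)
  have "real (kstar (path_graph l) 2) \<le> real (size_bound (p + p))"
    using kstar_builder_wins[OF builder_wins_size_bound[OF p]] by simp
  also have "\<dots> \<le> x ^ (p + p)" using size_bound_le[of "p + p"] by (simp add: x_def)
  also have "\<dots> = x powr real (p + p)" using x by (intro powr_realpow[symmetric]) simp
  also have "\<dots> = (2 powr log 2 x) powr real (p + p)" using x by simp
  also have "\<dots> = (2 powr real p) powr (2 * log 2 x)" by (simp add: powr_powr algebra_simps)
  also have "\<dots> = (2 ^ p) powr (2 * log 2 x)" by (simp add: powr_realpow)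
  also have "\<dots> \<le> (2 * real l) powr (2 * log 2 x)"
    using 2 x by (intro powr_mono2) auto
  also have "\<dots> = 2 powr (2 * log 2 x) * real l powr (2 * log 2 x)"
    by (simp add: powr_mult)
  finally show ?thesis by (simp add: x_def)
qed

theorem theorem6:
  shows "(\<forall>l. \<exists>k. builder_wins (path_graph l) 2 k) \<and>
    (\<exists>\<epsilon> :: nat \<Rightarrow> real. \<epsilon> \<longlonglongrightarrow> 0 \<and>
       (\<forall>\<^sub>F l in sequentially. (8 / 15 + \<epsilon> l) * (real l)\<^sup>2 \<le> real (kstar (path_graph l) 2))) \<and>
    (\<lambda>l. real (kstar (path_graph l) 2)) \<in> O(\<lambda>l. real l powr (2 * log 2 (1 + sqrt 3)))"
proof (intro conjI allI exI[of _ "\<lambda>l. - 5 / real l"])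
  \<comment> \<open>Taking \<open>p = l\<close> is enough here. That Builder wins for some
    \<open>k\<close> is what gives \<open>kstar\<close> its meaning in the other two claims.\<close>
  show wins: "\<exists>k. builder_wins (path_graph l) 2 k" for l
    using builder_wins_size_bound[OF less_exp] by blast
  show "(\<lambda>l. - 5 / real l) \<longlonglongrightarrow> 0"
    by (rule lim_const_over_n)
  \<comment> \<open>The witness \<open>- 5 / l\<close> is the linear loss \<open>5 * l\<close> of
    \<open>builder_wins_bound\<close> divided by the square of \<open>l\<close>.\<close>
  show "\<forall>\<^sub>F l in sequentially. (8 / 15 + - 5 / real l) * (real l)\<^sup>2 \<le> real (kstar (path_graph l) 2)"
    using eventually_ge_at_top[of 5]
  proof eventually_elim
    case (elim l)
    have "(8 / 15 + - 5 / real l) * (real l)\<^sup>2 = 8 / 15 * (real l)\<^sup>2 - 5 * real l"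
      using elim by (simp add: field_simps power2_eq_square)
    also have "\<dots> \<le> real (kstar (path_graph l) 2)"
      using builder_wins_bound[OF _ elim] kstar_builder_wins wins by blast
    finally show ?case .
  qed
  show "(\<lambda>l. real (kstar (path_graph l) 2)) \<in> O(\<lambda>l. real l powr (2 * log 2 (1 + sqrt 3)))"
  proof (rule bigoI)
    show "\<forall>\<^sub>F l in sequentially. norm (real (kstar (path_graph l) 2)) \<le>
        2 powr (2 * log 2 (1 + sqrt 3)) * norm (real l powr (2 * log 2 (1 + sqrt 3)))"
      using eventually_ge_at_top[of 1] by eventually_elim (use kstar_le in simp)
  qed
qed

end
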